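(* Let $N\in\mathbb N$, $\lambda\ge 0$, $L=N(1+\lambda)$, $m\in\mathbb N\setminus\{1\}$, and $f\in\mathcal B_{N/2}(\mathbb R)$. Let $R_{\mathrm{rect},m}f$ be the rectangular regularized Shannon sampling formula with localized sampling. Then $$\|f-R_{\mathrm{rect},m}f\|_{C_0(\mathbb R)}\le\frac{\sqrt L}{\pi}\sqrt{\frac2m+\frac1{m^2}}\;\|f\|_{L^2(\mathbb R)}.$$
   Context: Fourier transform: $\hat f(v)=\int_{\mathbb R}f(t)\,\mathrm e^{-2\pi\mathrm i tv}\,\mathrm dt$ (extended to $L^2(\mathbb R)$ by Plancherel). $\mathrm{sinc}\,x=\frac{\sin x}{x}$ for $x\ne0$ and $\mathrm{sinc}\,0=1$. $\|g\|_{C_0(\mathbb R)}:=\max_{t\in\mathbb R}|g(t)|$. Paley--Wiener space: $\mathcal B_\delta(\mathbb R)=\{f\in L^2(\mathbb R):\ \mathrm{supp}\,\hat f\subseteq[-\delta,\delta]\}$; each element is identified with its smooth representative, so point values make sense. The rectangular regularized Shannon sampling formula with localized sampling is $$(R_{\mathrm{rect},m}f)(t)=\sum_{\ell\in\mathbb Z}f\big(\tfrac{\ell}{L}\big)\,\mathrm{sinc}\big(L\pi(t-\tfrac{\ell}{L})\big)\,\mathbf 1_{[-m/L,m/L]}\big(t-\tfrac{\ell}{L}\big),\quad t\in\mathbb R,$$ where $\mathbf 1_{[-m/L,m/L]}$ is the indicator function of $[-m/L,m/L]$. *)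

theory Defs
  imports "HOL-Probability.Sinc_Integral"
begin

text \<open>Square integrable functions are represented by Borel functions on the real line; every class
  in \<open>L\<^sup>2(\<real>)\<close> has such a representative.\<close>

definition square_integrable :: "(real \<Rightarrow> complex) \<Rightarrow> bool" where
  "square_integrable f \<longleftrightarrow>
     f \<in> borel_measurable lborel \<and> integrable lborel (\<lambda>t. (norm (f t))\<^sup>2)"

definition L2_norm_real :: "(real \<Rightarrow> complex) \<Rightarrow> real" where
  "L2_norm_real f = sqrt (LINT t|lborel. (norm (f t))\<^sup>2)"

definition L2_converges :: "(nat \<Rightarrow> real \<Rightarrow> complex) \<Rightarrow> (real \<Rightarrow> complex) \<Rightarrow> bool" where
  "L2_converges F f \<longleftrightarrow>
     (\<forall>n. square_integrable (F n)) \<and> square_integrable f \<and>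
     (\<lambda>n. L2_norm_real (\<lambda>t. F n t - f t)) \<longlonglongrightarrow> 0"

definition fourier :: "(real \<Rightarrow> complex) \<Rightarrow> real \<Rightarrow> complex" where
  "fourier f v =
     (LINT t|lborel. f t * exp (- 2 * complex_of_real pi * \<i> * complex_of_real (t * v)))"

text \<open>\<open>has_L2_fourier f g\<close>: \<open>g\<close> represents the Fourier transform of \<open>f \<in> L\<^sup>2(\<real>)\<close>, i.e. the value at
  \<open>f\<close> of the continuous extension of \<open>fourier\<close> from \<open>L\<^sup>1(\<real>) \<inter> L\<^sup>2(\<real>)\<close> to \<open>L\<^sup>2(\<real>)\<close>. By Plancherel's
  theorem such a \<open>g\<close> exists for every \<open>f \<in> L\<^sup>2(\<real>)\<close>, is unique up to null sets, and does not depend on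
  the approximating sequence.\<close>

definition has_L2_fourier :: "(real \<Rightarrow> complex) \<Rightarrow> (real \<Rightarrow> complex) \<Rightarrow> bool" where
  "has_L2_fourier f g \<longleftrightarrow>
     (\<exists>F. (\<forall>n. integrable lborel (F n)) \<and> L2_converges F f \<and>
          L2_converges (\<lambda>n. fourier (F n)) g)"

text \<open>The support of an almost-everywhere class: the complement of the largest open set on which the
  function vanishes almost everywhere.\<close>

definition ess_support :: "(real \<Rightarrow> complex) \<Rightarrow> real set" where
  "ess_support g = - \<Union>{U. open U \<and> (AE v in lborel. v \<in> U \<longrightarrow> g v = 0)}"

definition smooth_fun :: "(real \<Rightarrow> complex) \<Rightarrow> bool" where
  "smooth_fun f \<longleftrightarrow>
     (\<exists>D :: nat \<Rightarrow> real \<Rightarrow> complex. D 0 = f \<and>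
        (\<forall>n t. (D n has_vector_derivative D (Suc n) t) (at t)))"

text \<open>The elements of the Paley--Wiener space are taken to be the smooth representatives, so that
  point values are meaningful.\<close>

definition paley_wiener :: "real \<Rightarrow> (real \<Rightarrow> complex) set" where
  "paley_wiener \<delta> =
     {f. smooth_fun f \<and> square_integrable f \<and>
         (\<exists>g. has_L2_fourier f g \<and> ess_support g \<subseteq> {-\<delta>..\<delta>})}"

definition R_rect :: "real \<Rightarrow> nat \<Rightarrow> (real \<Rightarrow> complex) \<Rightarrow> real \<Rightarrow> complex" where
  "R_rect L m f t =
     (\<Sum>\<^sub>\<infinity>l\<in>(UNIV :: int set).
        f (of_int l / L) * complex_of_real (sinc (L * pi * (t - of_int l / L))) *
        indicator {- (real m / L)..real m / L} (t - of_int l / L))"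

definition C0_space :: "(real \<Rightarrow> complex) set" where
  "C0_space = {g. continuous_on UNIV g \<and> (g \<longlongrightarrow> 0) at_infinity}"

text \<open>For elements of the space above this supremum is attained, hence equal to the maximum.\<close>

definition C0_norm :: "(real \<Rightarrow> complex) \<Rightarrow> real" where
  "C0_norm g = (SUP t. norm (g t))"

end

theory Submission
  imports Defs "HOL-Probability.Characteristic_Functions"
begin

text \<open>The idea is to compare \<open>f\<close> and its sampling formula on the Fourier side. If \<open>g\<close> represents the
  Fourier transform of \<open>f\<close>, then \<open>f(s) = \<integral> g(v) exp (2\<pi>i s v) dv\<close> for every \<open>s\<close>
  (\<open>has_L2_fourier_inversion\<close>), and \<open>g\<close> may be taken to vanish off \<open>[-N/2, N/2] \<subseteq> [-L/2, L/2]\<close>. For fixed \<open>t\<close>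
  only the finitely many integers \<open>l\<close> with \<open>|L t - l| \<le> m\<close> contribute to the sampling sum, so the
  error at \<open>t\<close> is the integral of \<open>g\<close> against the residual
  \<open>exp (2\<pi>i t v) - \<Sum> c\<^sub>l exp (2\<pi>i v l/L)\<close> with \<open>c\<^sub>l = sinc (\<pi> (L t - l))\<close>.

  The exponentials \<open>exp (2\<pi>i v l/L)\<close> are orthogonal on \<open>[-L/2, L/2]\<close>, and the \<open>c\<^sub>l\<close> are precisely the Fourier
  coefficients of \<open>exp (2\<pi>i t v)\<close> there. The residual is therefore that of an orthogonal projection, and its
  squared norm is \<open>L (1 - \<Sum> c\<^sub>l\<^sup>2)\<close> (\<open>L2_norm_sampling_residual\<close>).

  What remains is a statement about numbers (\<open>sinc_tail_le\<close>). The partial fraction expansion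
  \<open>\<Sum> 1/(x - l)\<^sup>2 = (\<pi> / sin (\<pi> x))\<^sup>2\<close> over all integers \<open>l\<close>, obtained by differentiating the
  logarithm of Euler's reflection formula for \<open>\<Gamma>\<close> twice, says that all the \<open>c\<^sub>l\<^sup>2\<close> add up to 1. So
  \<open>1 - \<Sum> c\<^sub>l\<^sup>2\<close> is the sum of the omitted terms, which telescoping bounds by
  \<open>(2/m + 1/m\<^sup>2) / \<pi>\<^sup>2\<close>. The Cauchy--Schwarz inequality and \<open>\<parallel>g\<parallel> \<le> \<parallel>f\<parallel>\<close> give the claimed estimate.

  The two facts about the Fourier transform on \<open>L\<^sup>2\<close>, inversion and \<open>\<parallel>g\<parallel> \<le> \<parallel>f\<parallel>\<close>, are both derived from
  one identity, \<open>fourier_gaussian_pairing\<close>: pairing the transform of \<open>f\<close> with a modulated Gaussian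
  is the same as averaging \<open>f\<close> against a normal density.

  The error is continuous because the cut-off of sinc is made at zeros of sinc. It tends to 0 because
  \<open>f\<close> does, being Lipschitz and square integrable.\<close>

section \<open>Square integrable functions\<close>

lemma L2_norm_real_nonneg: "0 \<le> L2_norm_real f"
  by (simp add: L2_norm_real_def)

lemma L2_norm_real_power2: "(L2_norm_real f)\<^sup>2 = (LINT t|lborel. (norm (f t))\<^sup>2)"
  by (simp add: L2_norm_real_def)

lemma square_integrable_norm_product:
  assumes "square_integrable f" "square_integrable g"
  shows "integrable lborel (\<lambda>t. norm (f t) * norm (g t))"
proof (rule Bochner_Integration.integrable_bound)
  have [measurable]: "f \<in> borel_measurable lborel" "g \<in> borel_measurable lborel"
    using assms by (auto simp: square_integrable_def)
  show "integrable lborel (\<lambda>t. (norm (f t))\<^sup>2 + (norm (g t))\<^sup>2)"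
    using assms by (auto simp: square_integrable_def)
  show "(\<lambda>t. norm (f t) * norm (g t)) \<in> borel_measurable lborel" by measurable
  have "norm (f t) * norm (g t) \<le> (norm (f t))\<^sup>2 + (norm (g t))\<^sup>2" for t
    using sum_squares_bound[of "norm (f t)" "norm (g t)"]
      mult_nonneg_nonneg[OF norm_ge_zero norm_ge_zero, of "f t" "g t"]
    unfolding mult.assoc by linarith
  then show "AE t in lborel. norm (norm (f t) * norm (g t))
      \<le> norm ((norm (f t))\<^sup>2 + (norm (g t))\<^sup>2)"
    by (intro AE_I2) (simp add: abs_mult)
qed

lemma square_integrable_product:
  assumes "square_integrable f" "square_integrable g"
  shows "integrable lborel (\<lambda>t. f t * g t)"
proof (rule Bochner_Integration.integrable_bound[OF square_integrable_norm_product[OF assms]])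
  have [measurable]: "f \<in> borel_measurable lborel" "g \<in> borel_measurable lborel"
    using assms by (auto simp: square_integrable_def)
  show "(\<lambda>t. f t * g t) \<in> borel_measurable lborel" by measurable
  have "norm (f t * g t) \<le> norm (norm (f t) * norm (g t))" for t
    unfolding norm_mult real_norm_def abs_mult by simp
  then show "AE t in lborel. norm (f t * g t) \<le> norm (norm (f t) * norm (g t))"
    by (rule AE_I2)
qed

lemma Cauchy_Schwarz_norm_product:
  assumes "square_integrable f" "square_integrable g"
  shows "(LINT t|lborel. norm (f t) * norm (g t)) \<le> L2_norm_real f * L2_norm_real g"
proof -
  define A B C where "A = (LINT t|lborel. (norm (f t))\<^sup>2)" and "B = (LINT t|lborel. (norm (g t))\<^sup>2)"
    and "C = (LINT t|lborel. norm (f t) * norm (g t))"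
  have int: "integrable lborel (\<lambda>t. (norm (f t))\<^sup>2)" "integrable lborel (\<lambda>t. (norm (g t))\<^sup>2)"
    "integrable lborel (\<lambda>t. norm (f t) * norm (g t))"
    using assms square_integrable_norm_product by (auto simp: square_integrable_def)
  have AB: "A \<ge> 0" "B \<ge> 0" by (auto simp: A_def B_def)
  \<comment> \<open>The classical argument: a nonnegative quadratic in \<open>r\<close> has discriminant at most 0.\<close>
  have quad: "0 \<le> A - 2 * r * C + r\<^sup>2 * B" for r
  proof -
    have "0 \<le> (LINT t|lborel. (norm (f t) - r * norm (g t))\<^sup>2)" by simp
    also have "\<dots> = (LINT t|lborel. (norm (f t))\<^sup>2 - 2 * r * (norm (f t) * norm (g t)) + r\<^sup>2 * (norm (g t))\<^sup>2)"
      by (intro Bochner_Integration.integral_cong refl) (simp add: power2_diff power_mult_distrib)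
    also have "\<dots> = A - 2 * r * C + r\<^sup>2 * B"
      unfolding A_def B_def C_def using int by simp
    finally show ?thesis .
  qed
  have "C\<^sup>2 \<le> A * B"
  proof (cases "B = 0")
    case True
    have "C \<le> 0"
    proof (rule ccontr)
      assume "\<not> C \<le> 0"
      then have "2 * ((A + 1) / C) * C = 2 * (A + 1)" by simp
      then show False using quad[of "(A + 1) / C"] True AB by simp
    qed
    moreover have "C \<ge> 0" by (simp add: C_def)
    ultimately show ?thesis using True by simp
  next
    case False
    then show ?thesis using quad[of "C / B"] AB
      by (simp add: field_simps power2_eq_square)
  qed
  then have "C \<le> sqrt (A * B)" by (rule real_le_rsqrt)
  then show ?thesis by (simp add: L2_norm_real_def A_def B_def C_def real_sqrt_mult)
qed

lemma Cauchy_Schwarz_L2: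
  assumes "square_integrable f" "square_integrable g"
  shows "norm (LINT t|lborel. f t * g t) \<le> L2_norm_real f * L2_norm_real g"
proof -
  have "norm (LINT t|lborel. f t * g t) \<le> (LINT t|lborel. norm (f t * g t))"
    by (rule integral_norm_bound)
  also have "\<dots> \<le> L2_norm_real f * L2_norm_real g"
    using Cauchy_Schwarz_norm_product[OF assms] by (simp add: norm_mult)
  finally show ?thesis .
qed

lemma
  assumes "square_integrable f" "square_integrable g"
  shows square_integrable_add: "square_integrable (\<lambda>t. f t + g t)"
    and Minkowski_L2: "L2_norm_real (\<lambda>t. f t + g t) \<le> L2_norm_real f + L2_norm_real g"
proof -
  have [measurable]: "f \<in> borel_measurable lborel" "g \<in> borel_measurable lborel"
    using assms by (auto simp: square_integrable_def)
  let ?M = "\<lambda>t. (norm (f t))\<^sup>2 + 2 * (norm (f t) * norm (g t)) + (norm (g t))\<^sup>2"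
  have intf: "integrable lborel (\<lambda>t. (norm (f t))\<^sup>2)" "integrable lborel (\<lambda>t. (norm (g t))\<^sup>2)"
    using assms by (auto simp: square_integrable_def)
  have int: "integrable lborel ?M"
    using intf square_integrable_norm_product[OF assms] by auto
  have le: "(norm (f t + g t))\<^sup>2 \<le> ?M t" for t
    using power_mono[OF norm_triangle_ineq[of "f t" "g t"], of 2]
    by (simp add: power2_sum algebra_simps)
  show sq: "square_integrable (\<lambda>t. f t + g t)"
    unfolding square_integrable_def
  proof
    show "integrable lborel (\<lambda>t. (norm (f t + g t))\<^sup>2)"
    proof (rule Bochner_Integration.integrable_bound[OF int])
      show "AE t in lborel. norm ((norm (f t + g t))\<^sup>2) \<le> norm (?M t)"
        by (rule AE_I2) (use le in \<open>simp add: abs_le_D1 order_trans[OF le abs_ge_self]\<close>)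
    qed measurable
  qed measurable
  have "(LINT t|lborel. (norm (f t + g t))\<^sup>2) \<le> (LINT t|lborel. ?M t)"
    using sq int le by (intro integral_mono) (auto simp: square_integrable_def)
  also have "\<dots> = (L2_norm_real f)\<^sup>2 + 2 * (LINT t|lborel. norm (f t) * norm (g t)) + (L2_norm_real g)\<^sup>2"
    using intf square_integrable_norm_product[OF assms] by (simp add: L2_norm_real_power2)
  also have "\<dots> \<le> (L2_norm_real f + L2_norm_real g)\<^sup>2"
    using Cauchy_Schwarz_norm_product[OF assms] by (simp add: power2_sum)
  finally show "L2_norm_real (\<lambda>t. f t + g t) \<le> L2_norm_real f + L2_norm_real g"
    unfolding L2_norm_real_def[of "\<lambda>t. f t + g t"]
    by (intro real_le_lsqrt add_nonneg_nonneg L2_norm_real_nonneg)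
qed

lemma square_integrable_diff:
  assumes "square_integrable f" "square_integrable g"
  shows "square_integrable (\<lambda>t. f t - g t)"
proof -
  have "square_integrable (\<lambda>t. - g t)"
    using assms(2) by (auto simp: square_integrable_def)
  from square_integrable_add[OF assms(1) this] show ?thesis by simp
qed

lemma L2_norm_real_minus_commute:
  "L2_norm_real (\<lambda>t. f t - g t) = L2_norm_real (\<lambda>t. g t - f t)"
  by (simp add: L2_norm_real_def norm_minus_commute)

lemma L2_convergesD:
  assumes "L2_converges F f"
  shows "square_integrable (F n)" "square_integrable f"
    "(\<lambda>n. L2_norm_real (\<lambda>t. F n t - f t)) \<longlonglongrightarrow> 0"
  using assms by (auto simp: L2_converges_def)

lemma L2_converges_norm:
  assumes "L2_converges F f"
  shows "(\<lambda>n. L2_norm_real (F n)) \<longlonglongrightarrow> L2_norm_real f"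
proof -
  note F = L2_convergesD[OF assms]
  have le: "\<bar>L2_norm_real (F n) - L2_norm_real f\<bar> \<le> L2_norm_real (\<lambda>t. F n t - f t)" for n
    using Minkowski_L2[OF square_integrable_diff[OF F(1,2)] F(2), of n]
      Minkowski_L2[OF square_integrable_diff[OF F(2,1)] F(1), of n n]
    by (simp add: L2_norm_real_minus_commute[of f "F n"])
  have "(\<lambda>n. L2_norm_real (F n) - L2_norm_real f) \<longlonglongrightarrow> 0"
    by (rule Lim_null_comparison[OF always_eventually F(3)]) (use le in simp)
  then show ?thesis by (simp add: LIM_zero_iff)
qed

text \<open>This carries integral identities from \<open>L\<^sup>1 \<inter> L\<^sup>2\<close>, where the transform is an integral, over to
  \<open>L\<^sup>2\<close>, where it is only a limit.\<close>

lemma L2_converges_pairing: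
  assumes "L2_converges F f" "square_integrable g"
  shows "(\<lambda>n. LINT t|lborel. F n t * g t) \<longlonglongrightarrow> (LINT t|lborel. f t * g t)"
proof -
  note F = L2_convergesD[OF assms(1)]
  have le: "norm ((LINT t|lborel. F n t * g t) - (LINT t|lborel. f t * g t))
      \<le> L2_norm_real (\<lambda>t. F n t - f t) * L2_norm_real g" for n
    using Cauchy_Schwarz_L2[OF square_integrable_diff[OF F(1,2)] assms(2), of n]
      square_integrable_product[OF F(1) assms(2), of n] square_integrable_product[OF F(2) assms(2)]
    by (simp add: left_diff_distrib)
  have lim: "(\<lambda>n. L2_norm_real (\<lambda>t. F n t - f t) * L2_norm_real g) \<longlonglongrightarrow> 0"
    using tendsto_mult[OF F(3) tendsto_const[of "L2_norm_real g"]] by simp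
  have "(\<lambda>n. (LINT t|lborel. F n t * g t) - (LINT t|lborel. f t * g t)) \<longlonglongrightarrow> 0"
    by (rule Lim_null_comparison[OF always_eventually lim]) (use le in simp)
  then show ?thesis by (simp add: LIM_zero_iff)
qed

section \<open>The Fourier integral of Gaussians\<close>

lemma fourier_kernel_eq_cis:
  "exp (- 2 * complex_of_real pi * \<i> * complex_of_real x) = cis (- 2 * pi * x)"
  by (simp add: cis_conv_exp mult_ac)

lemma borel_measurable_cis [measurable (raw)]:
  "f \<in> borel_measurable M \<Longrightarrow> (\<lambda>x. cis (f x)) \<in> borel_measurable M"
  by (rule measurable_compose[of f M borel])
    (auto intro!: borel_measurable_continuous_onI continuous_on_cis continuous_on_id)

lemma fourier_cis: "fourier f v = (LINT t|lborel. f t * cis (- 2 * pi * (t * v)))"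
  unfolding fourier_def fourier_kernel_eq_cis ..

lemma integrable_mult_cis:
  assumes "integrable lborel f" "h \<in> borel_measurable lborel"
  shows "integrable lborel (\<lambda>t. f t * cis (h t))"
proof (rule Bochner_Integration.integrable_bound[OF assms(1)])
  note [measurable] = borel_measurable_integrable[OF assms(1)] assms(2)
  show "(\<lambda>t. f t * cis (h t)) \<in> borel_measurable lborel" by measurable
qed (simp add: norm_mult)

lemma borel_measurable_fourier:
  assumes "integrable lborel f"
  shows "fourier f \<in> borel_measurable lborel"
proof -
  note [measurable] = borel_measurable_integrable[OF assms]
  have "(\<lambda>v. LINT t|lborel. f t * cis (- 2 * pi * (t * v))) \<in> borel_measurable lborel"
    by measurable
  then show ?thesis by (simp add: fourier_cis[abs_def])
qed

lemma norm_fourier_le: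
  "norm (fourier f v) \<le> (LINT t|lborel. norm (f t))"
  unfolding fourier_cis by (rule order_trans[OF integral_norm_bound]) (simp add: norm_mult)

text \<open>Both sides are the double integral of \<open>f(t) h(v) exp (- 2\<pi>i t v)\<close>, which converges absolutely.\<close>

lemma fourier_multiplication_formula:
  assumes "integrable lborel f" "integrable lborel h"
  shows "(LINT v|lborel. fourier f v * h v) = (LINT t|lborel. f t * fourier h t)"
proof -
  note [measurable] = borel_measurable_integrable[OF assms(1)] borel_measurable_integrable[OF assms(2)]
  let ?k = "\<lambda>t v. f t * h v * cis (- 2 * pi * (t * v))"
  have int: "integrable (lborel \<Otimes>\<^sub>M lborel) (case_prod ?k)"
  proof (rule lborel_pair.Fubini_integrable)
    show "case_prod ?k \<in> borel_measurable (lborel \<Otimes>\<^sub>M lborel)" by measurable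
    show "integrable lborel (\<lambda>t. LINT v|lborel. norm (case_prod ?k (t, v)))"
      using assms by (simp add: norm_mult)
    show "AE t in lborel. integrable lborel (\<lambda>v. case_prod ?k (t, v))"
      using assms by (simp add: integrable_mult_cis)
  qed
  have "(LINT v|lborel. fourier f v * h v) = (LINT v|lborel. LINT t|lborel. ?k t v)"
    unfolding fourier_cis integral_mult_left_zero[symmetric] by (simp add: mult_ac)
  also have "\<dots> = (LINT t|lborel. LINT v|lborel. ?k t v)"
    by (rule lborel_pair.Fubini_integral[OF int])
  also have "\<dots> = (LINT t|lborel. f t * fourier h t)"
    unfolding fourier_cis integral_mult_right_zero[symmetric] by (simp add: mult_ac)
  finally show ?thesis .
qed

text \<open>The Gaussians are parametrised by their width \<open>1/a\<close> on the frequency side, so that \<open>a \<rightarrow> 0\<close> makes the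
  weight tend to 1 while its transform, a normal density of standard deviation \<open>a / (2\<pi>)\<close>, concentrates
  at a point.\<close>

lemma gaussian_eq_normal_density:
  fixes a :: real
  assumes "a > 0"
  shows "exp (- (a * v)\<^sup>2 / 2) = sqrt (2 * pi) / a * normal_density 0 (1 / a) v"
  using assms by (simp add: normal_density_def real_sqrt_divide real_sqrt_mult power_mult_distrib field_simps)

lemma integrable_gaussian:
  fixes a :: real
  assumes "a > 0"
  shows "integrable lborel (\<lambda>v. exp (- (a * v)\<^sup>2 / 2))"
  unfolding gaussian_eq_normal_density[OF assms] using assms by simp

text \<open>After the substitution \<open>w = a v\<close> this is the characteristic function of the standard normal
  distribution, evaluated at \<open>- 2\<pi>t / a\<close>.\<close>

lemma fourier_gaussian:
  assumes a: "a > 0"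
  shows "fourier (\<lambda>v. complex_of_real (exp (- (a * v)\<^sup>2 / 2))) t
    = of_real (normal_density 0 (a / (2 * pi)) t)"
proof -
  define u where "u = - 2 * pi * t / a"
  have "of_real (exp (- u\<^sup>2 / 2)) = char std_normal_distribution u"
    by (simp add: char_std_normal_distribution)
  also have "\<dots> = (LINT w|lborel. std_normal_density w *\<^sub>R cis (u * w))"
    unfolding char_def by (subst integral_density) (auto simp: cis_conv_exp)
  also have "\<dots> = a *\<^sub>R (LINT v|lborel. std_normal_density (a * v) *\<^sub>R cis (u * (a * v)))"
    using lborel_integral_real_affine[of a "\<lambda>w. std_normal_density w *\<^sub>R cis (u * w)" 0] a by simp
  also have "\<dots> = a *\<^sub>R (LINT v|lborel. complex_of_real (1 / sqrt (2 * pi)) *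
      (complex_of_real (exp (- (a * v)\<^sup>2 / 2)) * cis (- 2 * pi * (v * t))))"
    using a by (simp add: std_normal_density_def scaleR_conv_of_real u_def mult_ac)
  also have "\<dots> = of_real (a / sqrt (2 * pi)) *
      fourier (\<lambda>v. complex_of_real (exp (- (a * v)\<^sup>2 / 2))) t"
    by (simp only: integral_mult_right_zero fourier_cis scaleR_conv_of_real) simp
  finally have "fourier (\<lambda>v. complex_of_real (exp (- (a * v)\<^sup>2 / 2))) t
      = of_real (sqrt (2 * pi) / a * exp (- u\<^sup>2 / 2))"
    using a by (simp add: field_simps)
  also have "sqrt (2 * pi) / a * exp (- u\<^sup>2 / 2) = normal_density 0 (a / (2 * pi)) t"
  proof -
    have "2 * pi * (a / (2 * pi))\<^sup>2 = a\<^sup>2 / (2 * pi)"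
      by (simp add: power2_eq_square)
    then have "sqrt (2 * pi * (a / (2 * pi))\<^sup>2) = a / sqrt (2 * pi)"
      using a by (simp add: real_sqrt_divide)
    moreover have "u\<^sup>2 / 2 = t\<^sup>2 / (2 * (a / (2 * pi))\<^sup>2)"
      using a by (simp add: u_def power2_eq_square field_simps)
    ultimately show ?thesis by (simp add: normal_density_def)
  qed
  finally show ?thesis .
qed

text \<open>The modulation by \<open>exp (2\<pi>i s v)\<close> translates the transform of the Gaussian to \<open>s\<close>; the rest is the
  multiplication formula. This is a smoothed form of Fourier inversion at \<open>s\<close>.\<close>

lemma fourier_gaussian_pairing:
  assumes f: "integrable lborel f" and a: "a > 0"
  shows "(LINT v|lborel. fourier f v * (of_real (exp (- (a * v)\<^sup>2 / 2)) * cis (2 * pi * s * v)))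
    = (LINT t|lborel. f t * of_real (normal_density 0 (a / (2 * pi)) (t - s)))"
proof -
  let ?h = "\<lambda>v. complex_of_real (exp (- (a * v)\<^sup>2 / 2)) * cis (2 * pi * s * v)"
  have "integrable lborel ?h"
    using integrable_gaussian[OF a] by (intro integrable_mult_cis) auto
  moreover have "fourier ?h t = of_real (normal_density 0 (a / (2 * pi)) (t - s))" for t
    unfolding fourier_gaussian[OF a, symmetric] unfolding fourier_cis
    by (intro Bochner_Integration.integral_cong refl)
      (simp add: mult.assoc cis_mult algebra_simps)
  ultimately show ?thesis
    using fourier_multiplication_formula[OF f, of ?h] by simp
qed

section \<open>The Fourier transform does not increase the L2 norm\<close>

lemma nn_integral_normal_density:
  "\<sigma> > 0 \<Longrightarrow> (\<integral>\<^sup>+ t. ennreal (normal_density \<mu> \<sigma> t) \<partial>lborel) = 1"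
  by (subst nn_integral_eq_integral) auto

lemma normal_density_shift: "normal_density 0 \<sigma> (t - s) = normal_density s \<sigma> t"
  by (simp add: normal_density_def)

lemma normal_density_swap: "normal_density s \<sigma> t = normal_density t \<sigma> s"
  by (simp add: normal_density_def power2_commute)

lemma normal_density_le:
  "normal_density \<mu> \<sigma> t \<le> 1 / sqrt (2 * pi * \<sigma>\<^sup>2)"
  unfolding normal_density_def by (intro mult_left_le) auto

text \<open>By \<open>|f(s)| |f(t)| \<le> (|f(s)|\<^sup>2 + |f(t)|\<^sup>2) / 2\<close> the double integral splits into two parts, and in each
  of them the normal density integrates to 1 in the variable that \<open>f\<close> does not contain.\<close>

lemma gaussian_convolution_form_le:
  assumes f: "square_integrable f" and \<sigma>: "\<sigma> > 0"
  shows "(\<integral>\<^sup>+ s. ennreal (norm (f s)) * (\<integral>\<^sup>+ t. ennreal (norm (f t) * normal_density s \<sigma> t) \<partial>lborel) \<partial>lborel)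
    \<le> ennreal ((L2_norm_real f)\<^sup>2)"
proof -
  have [measurable]: "f \<in> borel_measurable lborel" using f by (auto simp: square_integrable_def)
  have [measurable]: "(\<lambda>(s, t). normal_density s \<sigma> t) \<in> borel_measurable (borel \<Otimes>\<^sub>M borel)"
    unfolding normal_density_def by measurable
  let ?q = "\<lambda>s. ennreal ((norm (f s))\<^sup>2 / 2)"
  have half: "(\<integral>\<^sup>+ s. ?q s \<partial>lborel) = ennreal ((L2_norm_real f)\<^sup>2 / 2)"
    using f by (subst nn_integral_eq_integral) (auto simp: square_integrable_def L2_norm_real_power2)
  have "(\<integral>\<^sup>+ s. ennreal (norm (f s)) * (\<integral>\<^sup>+ t. ennreal (norm (f t) * normal_density s \<sigma> t) \<partial>lborel) \<partial>lborel)
     = (\<integral>\<^sup>+ s. (\<integral>\<^sup>+ t. ennreal (norm (f s) * (norm (f t) * normal_density s \<sigma> t)) \<partial>lborel) \<partial>lborel)"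
    by (simp add: nn_integral_cmult ennreal_mult)
  also have "\<dots> \<le> (\<integral>\<^sup>+ s. (\<integral>\<^sup>+ t. ?q s * normal_density s \<sigma> t + ?q t * normal_density s \<sigma> t \<partial>lborel) \<partial>lborel)"
  proof (intro nn_integral_mono)
    fix s t
    have "norm (f s) * norm (f t) \<le> (norm (f s))\<^sup>2 / 2 + (norm (f t))\<^sup>2 / 2"
      using sum_squares_bound[of "norm (f s)" "norm (f t)"] by simp
    from mult_right_mono[OF this normal_density_nonneg[of s \<sigma> t]]
    show "ennreal (norm (f s) * (norm (f t) * normal_density s \<sigma> t))
      \<le> ?q s * normal_density s \<sigma> t + ?q t * normal_density s \<sigma> t"
      by (simp add: distrib_right mult.assoc flip: ennreal_mult ennreal_plus)
  qed
  also have "\<dots> = (\<integral>\<^sup>+ s. (\<integral>\<^sup>+ t. ?q s * normal_density s \<sigma> t \<partial>lborel) \<partial>lborel)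
      + (\<integral>\<^sup>+ s. (\<integral>\<^sup>+ t. ?q t * normal_density s \<sigma> t \<partial>lborel) \<partial>lborel)"
    by (simp add: nn_integral_add)
  also have "(\<integral>\<^sup>+ s. (\<integral>\<^sup>+ t. ?q t * normal_density s \<sigma> t \<partial>lborel) \<partial>lborel)
      = (\<integral>\<^sup>+ t. (\<integral>\<^sup>+ s. ?q t * normal_density s \<sigma> t \<partial>lborel) \<partial>lborel)"
    by (rule lborel_pair.Fubini') measurable
  also have "\<dots> = (\<integral>\<^sup>+ t. ?q t \<partial>lborel)"
    using \<sigma> by (simp add: nn_integral_cmult normal_density_swap[of _ \<sigma>] nn_integral_normal_density)
  also have "(\<integral>\<^sup>+ s. (\<integral>\<^sup>+ t. ?q s * normal_density s \<sigma> t \<partial>lborel) \<partial>lborel) = (\<integral>\<^sup>+ s. ?q s \<partial>lborel)"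
    using \<sigma> by (simp add: nn_integral_cmult nn_integral_normal_density)
  also have "(\<integral>\<^sup>+ s. ?q s \<partial>lborel) + (\<integral>\<^sup>+ s. ?q s \<partial>lborel) = ennreal ((L2_norm_real f)\<^sup>2)"
    unfolding half by (simp flip: ennreal_plus)
  finally show ?thesis .
qed

text \<open>With the weight, the squared modulus of the transform of \<open>f\<close> can be written as the pairing of that
  transform with the integrable function \<open>h(v)\<close>, the conjugate of the transform times the Gaussian. The
  multiplication formula turns the pairing into one of \<open>f\<close> with the transform of \<open>h\<close>, and by
  \<open>fourier_gaussian_pairing\<close> the latter is the conjugate of a normal average of \<open>f\<close>. The result is the
  quadratic form estimated in \<open>gaussian_convolution_form_le\<close>.\<close>

lemma gaussian_weighted_fourier_le:
  assumes f: "integrable lborel f" "square_integrable f" and a: "a > 0"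
  shows "(LINT v|lborel. (norm (fourier f v))\<^sup>2 * exp (- (a * v)\<^sup>2 / 2)) \<le> (L2_norm_real f)\<^sup>2"
proof -
  note [measurable] = borel_measurable_integrable[OF f(1)] borel_measurable_fourier[OF f(1)]
  have [measurable]: "cnj \<in> borel_measurable borel"
    by (intro borel_measurable_continuous_onI continuous_on_cnj continuous_on_id)
  let ?\<sigma> = "a / (2 * pi)"
  let ?h = "\<lambda>v. cnj (fourier f v) * of_real (exp (- (a * v)\<^sup>2 / 2))"
  let ?M = "LINT t|lborel. norm (f t)"
  have \<sigma>: "?\<sigma> > 0" using a by simp
  have h: "integrable lborel ?h"
  proof (rule Bochner_Integration.integrable_bound)
    show "integrable lborel (\<lambda>v. ?M * exp (- (a * v)\<^sup>2 / 2))"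
      using integrable_gaussian[OF a] by simp
    show "AE v in lborel. norm (?h v) \<le> norm (?M * exp (- (a * v)\<^sup>2 / 2))"
      using norm_fourier_le[of f]
      by (intro AE_I2) (simp add: norm_mult mult_right_mono)
  qed measurable
  have Fh: "fourier ?h s = cnj (LINT t|lborel. f t * of_real (normal_density s ?\<sigma> t))" for s
  proof -
    have "fourier ?h s = (LINT v|lborel. cnj (fourier f v * (of_real (exp (- (a * v)\<^sup>2 / 2)) * cis (2 * pi * s * v))))"
      unfolding fourier_cis[of ?h]
      by (intro Bochner_Integration.integral_cong refl) (simp add: cis_cnj mult_ac)
    also have "\<dots> = cnj (LINT v|lborel. fourier f v * (of_real (exp (- (a * v)\<^sup>2 / 2)) * cis (2 * pi * s * v)))"
      by (rule Bochner_Integration.integral_cnj)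
    finally show ?thesis
      unfolding fourier_gaussian_pairing[OF f(1) a] normal_density_shift .
  qed
  have "complex_of_real (LINT v|lborel. (norm (fourier f v))\<^sup>2 * exp (- (a * v)\<^sup>2 / 2))
      = (LINT v|lborel. fourier f v * ?h v)"
    unfolding integral_complex_of_real[symmetric]
    by (intro Bochner_Integration.integral_cong refl) (simp add: complex_norm_square[unfolded of_real_power] mult_ac)
  also have "\<dots> = (LINT s|lborel. f s * fourier ?h s)"
    by (rule fourier_multiplication_formula[OF f(1) h])
  finally have "ennreal (norm (complex_of_real (LINT v|lborel. (norm (fourier f v))\<^sup>2 * exp (- (a * v)\<^sup>2 / 2))))
      = ennreal (norm (LINT s|lborel. f s * fourier ?h s))" by simp
  also have "\<dots> \<le> (\<integral>\<^sup>+ s. ennreal (norm (f s * fourier ?h s)) \<partial>lborel)"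
  proof (rule integral_norm_bound_ennreal, rule Bochner_Integration.integrable_bound)
    show "integrable lborel (\<lambda>s. (LINT v|lborel. norm (?h v)) * norm (f s))" using f by simp
    have "norm (f s * fourier ?h s) \<le> (LINT v|lborel. norm (?h v)) * norm (f s)" for s
      using mult_right_mono[OF norm_fourier_le[of ?h s] norm_ge_zero[of "f s"]]
      unfolding norm_mult[of "f s"] by (simp only: mult.commute)
    then show "AE s in lborel. norm (f s * fourier ?h s) \<le> norm ((LINT v|lborel. norm (?h v)) * norm (f s))"
      unfolding real_norm_def by (intro AE_I2 order_trans[OF _ abs_ge_self])
    note [measurable] = borel_measurable_fourier[OF h]
    show "(\<lambda>s. f s * fourier ?h s) \<in> borel_measurable lborel" by measurable
  qed
  also have "\<dots> \<le> (\<integral>\<^sup>+ s. ennreal (norm (f s)) * (\<integral>\<^sup>+ t. ennreal (norm (f t) * normal_density s ?\<sigma> t) \<partial>lborel) \<partial>lborel)"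
  proof (rule nn_integral_mono)
    fix s
    have "integrable lborel (\<lambda>t. f t * of_real (normal_density s ?\<sigma> t))"
    proof (rule Bochner_Integration.integrable_bound)
      show "integrable lborel (\<lambda>t. norm (f t) * (1 / sqrt (2 * pi * ?\<sigma>\<^sup>2)))" using f by simp
      have "norm (f t * of_real (normal_density s ?\<sigma> t)) \<le> norm (f t) * (1 / sqrt (2 * pi * ?\<sigma>\<^sup>2))" for t
        unfolding norm_mult norm_of_real using normal_density_le[of s ?\<sigma> t]
        by (intro mult_left_mono) auto
      then show "AE t in lborel. norm (f t * of_real (normal_density s ?\<sigma> t))
          \<le> norm (norm (f t) * (1 / sqrt (2 * pi * ?\<sigma>\<^sup>2)))"
        by (intro AE_I2) (auto intro: order_trans[OF _ abs_ge_self])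
    qed measurable
    then have "ennreal (norm (fourier ?h s)) \<le> (\<integral>\<^sup>+ t. ennreal (norm (f t * of_real (normal_density s ?\<sigma> t))) \<partial>lborel)"
      unfolding Fh complex_mod_cnj by (rule integral_norm_bound_ennreal)
    then show "ennreal (norm (f s * fourier ?h s))
        \<le> ennreal (norm (f s)) * (\<integral>\<^sup>+ t. ennreal (norm (f t) * normal_density s ?\<sigma> t) \<partial>lborel)"
      by (simp add: norm_mult ennreal_mult mult_left_mono)
  qed
  also have "\<dots> \<le> ennreal ((L2_norm_real f)\<^sup>2)"
    by (rule gaussian_convolution_form_le[OF f(2) \<sigma>])
  finally have "norm (complex_of_real (LINT v|lborel. (norm (fourier f v))\<^sup>2 * exp (- (a * v)\<^sup>2 / 2))) \<le> (L2_norm_real f)\<^sup>2"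
    by (subst (asm) ennreal_le_iff) auto
  then show ?thesis by simp
qed

text \<open>One half of Plancherel's theorem: let the Gaussian weight widen to 1 in \<open>gaussian_weighted_fourier_le\<close>.\<close>

lemma L2_norm_fourier_le:
  assumes f: "integrable lborel f" "square_integrable f" and F: "square_integrable (fourier f)"
  shows "L2_norm_real (fourier f) \<le> L2_norm_real f"
proof -
  note [measurable] = borel_measurable_fourier[OF f(1)]
  let ?a = "\<lambda>n. 1 / real (Suc n)"
  have "(\<lambda>n. LINT v|lborel. (norm (fourier f v))\<^sup>2 * exp (- (?a n * v)\<^sup>2 / 2))
      \<longlonglongrightarrow> (LINT v|lborel. (norm (fourier f v))\<^sup>2)"
  proof (rule integral_dominated_convergence)
    show "integrable lborel (\<lambda>v. (norm (fourier f v))\<^sup>2)" using F by (simp add: square_integrable_def)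
    have "(\<lambda>n. (norm (fourier f v))\<^sup>2 * exp (- (?a n * v)\<^sup>2 / 2)) \<longlonglongrightarrow> (norm (fourier f v))\<^sup>2 * exp (- (0 * v)\<^sup>2 / 2)" for v
      by (intro tendsto_intros LIMSEQ_Suc[OF lim_1_over_n]) auto
    then show "AE v in lborel. (\<lambda>n. (norm (fourier f v))\<^sup>2 * exp (- (?a n * v)\<^sup>2 / 2)) \<longlonglongrightarrow> (norm (fourier f v))\<^sup>2"
      by simp
    show "AE v in lborel. norm ((norm (fourier f v))\<^sup>2 * exp (- (?a n * v)\<^sup>2 / 2)) \<le> (norm (fourier f v))\<^sup>2" for n
      by (intro AE_I2) (simp add: abs_mult mult_left_le)
  qed measurable
  then have "(LINT v|lborel. (norm (fourier f v))\<^sup>2) \<le> (L2_norm_real f)\<^sup>2"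
    by (rule LIMSEQ_le_const2) (use gaussian_weighted_fourier_le[OF f, of "?a _"] in simp)
  then show ?thesis
    unfolding L2_norm_real_def[of "fourier f"] by (intro real_le_lsqrt L2_norm_real_nonneg)
qed

lemma has_L2_fourier_norm_le:
  assumes "has_L2_fourier f g"
  shows "L2_norm_real g \<le> L2_norm_real f"
proof -
  obtain F where F: "\<And>n. integrable lborel (F n)" "L2_converges F f" "L2_converges (\<lambda>n. fourier (F n)) g"
    using assms by (auto simp: has_L2_fourier_def)
  show ?thesis
    using L2_norm_fourier_le[OF F(1) L2_convergesD(1)[OF F(2)] L2_convergesD(1)[OF F(3)]]
    by (intro LIMSEQ_le[OF L2_converges_norm[OF F(3)] L2_converges_norm[OF F(2)]]) auto
qed

section \<open>Pointwise Fourier inversion\<close>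

lemma square_integrable_bounded:
  assumes h: "integrable lborel h" and C: "\<And>t. norm (h t) \<le> C"
  shows "square_integrable h"
  unfolding square_integrable_def
proof
  note [measurable] = borel_measurable_integrable[OF h]
  show "h \<in> borel_measurable lborel" by measurable
  show "integrable lborel (\<lambda>t. (norm (h t))\<^sup>2)"
  proof (rule Bochner_Integration.integrable_bound)
    show "integrable lborel (\<lambda>t. C * norm (h t))" using h by simp
    show "AE t in lborel. norm ((norm (h t))\<^sup>2) \<le> norm (C * norm (h t))"
      using order_trans[OF norm_ge_zero C]
      by (intro AE_I2) (simp add: power2_eq_square abs_mult mult_right_mono C)
  qed measurable
qed

lemma has_L2_fourier_gaussian_pairing:
  assumes fg: "has_L2_fourier f g" and a: "a > 0"
  shows "(LINT v|lborel. g v * (of_real (exp (- (a * v)\<^sup>2 / 2)) * cis (2 * pi * s * v)))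
    = (LINT t|lborel. f t * of_real (normal_density s (a / (2 * pi)) t))"
proof -
  obtain F where F: "\<And>n. integrable lborel (F n)" "L2_converges F f" "L2_converges (\<lambda>n. fourier (F n)) g"
    using fg by (auto simp: has_L2_fourier_def)
  let ?h = "\<lambda>v. complex_of_real (exp (- (a * v)\<^sup>2 / 2)) * cis (2 * pi * s * v)"
  let ?G = "\<lambda>t. complex_of_real (normal_density s (a / (2 * pi)) t)"
  have "square_integrable ?h"
  proof (rule square_integrable_bounded)
    show "integrable lborel ?h" using integrable_gaussian[OF a] by (intro integrable_mult_cis) auto
    show "norm (?h v) \<le> 1" for v by (simp add: norm_mult)
  qed
  then have 1: "(\<lambda>n. LINT v|lborel. fourier (F n) v * ?h v) \<longlonglongrightarrow> (LINT v|lborel. g v * ?h v)"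
    by (rule L2_converges_pairing[OF F(3)])
  have "square_integrable ?G"
  proof (rule square_integrable_bounded)
    show "integrable lborel ?G" using a by simp
    show "norm (?G t) \<le> 1 / sqrt (2 * pi * (a / (2 * pi))\<^sup>2)" for t
      unfolding norm_of_real using normal_density_le[of s "a / (2 * pi)" t]
      by (simp add: abs_of_nonneg)
  qed
  then have "(\<lambda>n. LINT t|lborel. F n t * ?G t) \<longlonglongrightarrow> (LINT t|lborel. f t * ?G t)"
    by (rule L2_converges_pairing[OF F(2)])
  with 1 show ?thesis
    unfolding fourier_gaussian_pairing[OF F(1) a] normal_density_shift by (rule LIMSEQ_unique)
qed

lemma normal_density_affine:
  assumes "\<sigma> > 0"
  shows "\<sigma> * normal_density s \<sigma> (s + \<sigma> * u) = std_normal_density u"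
  using assms by (simp add: normal_density_def real_sqrt_mult power_mult_distrib)

text \<open>The Gaussian factor is estimated by \<open>exp (- x) \<le> 1/x\<close>, which already beats the factor \<open>1/\<sigma>\<close> in front.\<close>

lemma normal_density_tail_le:
  assumes \<sigma>: "\<sigma> > 0" and t: "\<bar>t - s\<bar> > 1"
  shows "normal_density s \<sigma> t \<le> \<sigma>"
proof -
  have t2: "(t - s)\<^sup>2 \<ge> 1" using power_mono[of 1 "\<bar>t - s\<bar>" 2] t by simp
  define x where "x = (t - s)\<^sup>2 / (2 * \<sigma>\<^sup>2)"
  have x: "x > 0" using t2 \<sigma> by (auto simp: x_def intro!: divide_pos_pos)
  have "exp (- x) \<le> 1 / x"
    using order_trans[OF less_imp_le[OF less_add_one] exp_ge_add_one_self[of x, unfolded add.commute[of 1]]] x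
    by (simp add: exp_minus field_simps)
  also have "\<dots> = 2 * \<sigma>\<^sup>2 / (t - s)\<^sup>2" by (simp add: x_def)
  also have "\<dots> \<le> 2 * \<sigma>\<^sup>2" using t2 by (simp add: divide_le_eq mult_le_cancel_left1)
  finally have e: "exp (- x) \<le> 2 * \<sigma>\<^sup>2" .
  have "2 \<le> sqrt (2 * pi)" using pi_gt3 by (intro real_le_rsqrt) simp
  then have s2: "2 * \<sigma> \<le> sqrt (2 * pi * \<sigma>\<^sup>2)" using \<sigma> by (simp add: real_sqrt_mult)
  have "normal_density s \<sigma> t = exp (- x) / sqrt (2 * pi * \<sigma>\<^sup>2)"
    by (simp add: normal_density_def x_def)
  also have "\<dots> \<le> (2 * \<sigma>\<^sup>2) / (2 * \<sigma>)"
    using e s2 \<sigma> by (intro frac_le) auto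
  also have "\<dots> = \<sigma>" using \<sigma> by (simp add: power2_eq_square)
  finally show ?thesis .
qed

text \<open>Since \<open>f\<close> need not be bounded, dominated convergence is available only near \<open>s\<close>. The part at distance
  more than 1 is controlled by the Cauchy--Schwarz inequality instead, as the tail of the normal density
  has \<open>L\<^sup>2\<close> norm at most \<open>sqrt \<sigma>\<close>.\<close>

lemma gaussian_approximate_identity:
  assumes f: "square_integrable f" "continuous_on UNIV f"
    and \<sigma>: "\<And>n. \<sigma> n > 0" "\<sigma> \<longlonglongrightarrow> (0::real)"
  shows "(\<lambda>n. LINT t|lborel. f t * of_real (normal_density s (\<sigma> n) t)) \<longlonglongrightarrow> f s"
proof -
  have [measurable]: "f \<in> borel_measurable lborel" using f by (simp add: square_integrable_def)
  define f1 where "f1 t = (if \<bar>t - s\<bar> \<le> 1 then f t else 0)" for t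
  define T where "T n t = (if \<bar>t - s\<bar> \<le> 1 then 0 else complex_of_real (normal_density s (\<sigma> n) t))" for n t
  have [measurable]: "f1 \<in> borel_measurable lborel" "\<And>n. T n \<in> borel_measurable lborel"
    unfolding f1_def[abs_def] T_def[abs_def] by measurable
  have "compact (f ` {s - 1..s + 1})"
    using f(2) by (intro compact_continuous_image) (auto intro: continuous_on_subset)
  then obtain C where C: "\<And>t. t \<in> {s - 1..s + 1} \<Longrightarrow> norm (f t) \<le> C"
    by (meson bounded_iff compact_imp_bounded imageI)
  have C0: "C \<ge> 0" using C[of s] by (simp add: order_trans[OF norm_ge_zero])
  have f1C: "norm (f1 t) \<le> C" for t using C[of t] C0 by (auto simp: f1_def abs_le_iff)
  have T: "square_integrable (T n)" "L2_norm_real (T n) \<le> sqrt (\<sigma> n)" for n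
  proof -
    have le: "(norm (T n t))\<^sup>2 \<le> \<sigma> n * normal_density s (\<sigma> n) t" for t
      using normal_density_tail_le[OF \<sigma>(1), of t s n] \<sigma>(1)[of n]
      by (auto simp: T_def power2_eq_square abs_of_nonneg intro!: mult_right_mono)
    have int: "integrable lborel (\<lambda>t. (norm (T n t))\<^sup>2)"
    proof (rule Bochner_Integration.integrable_bound)
      show "integrable lborel (\<lambda>t. \<sigma> n * normal_density s (\<sigma> n) t)" using \<sigma>(1) by simp
      show "AE t in lborel. norm ((norm (T n t))\<^sup>2) \<le> norm (\<sigma> n * normal_density s (\<sigma> n) t)"
        using le order_trans[OF le abs_ge_self] by (intro AE_I2) simp
    qed measurable
    then show "square_integrable (T n)" by (simp add: square_integrable_def)
    have "(LINT t|lborel. (norm (T n t))\<^sup>2) \<le> (LINT t|lborel. \<sigma> n * normal_density s (\<sigma> n) t)"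
      using int \<sigma>(1) le by (intro integral_mono) auto
    also have "\<dots> = \<sigma> n" using \<sigma>(1) by simp
    finally show "L2_norm_real (T n) \<le> sqrt (\<sigma> n)" by (simp add: L2_norm_real_def)
  qed
  have tail: "(\<lambda>n. LINT t|lborel. f t * T n t) \<longlonglongrightarrow> 0"
  proof (rule Lim_null_comparison[OF always_eventually])
    show "\<forall>n. norm (LINT t|lborel. f t * T n t) \<le> L2_norm_real f * sqrt (\<sigma> n)"
      using Cauchy_Schwarz_L2[OF f(1) T(1)] mult_left_mono[OF T(2) L2_norm_real_nonneg[of f]]
      by (meson order_trans)
    have "(\<lambda>n. L2_norm_real f * sqrt (\<sigma> n)) \<longlonglongrightarrow> L2_norm_real f * sqrt 0"
      by (intro tendsto_intros \<sigma>)
    then show "(\<lambda>n. L2_norm_real f * sqrt (\<sigma> n)) \<longlonglongrightarrow> 0" by simp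
  qed
  have near_int: "integrable lborel (\<lambda>t. f1 t * of_real (normal_density s (\<sigma> n) t))" for n
  proof (rule Bochner_Integration.integrable_bound)
    show "integrable lborel (\<lambda>t. C * normal_density s (\<sigma> n) t)" using \<sigma>(1) by simp
    show "AE t in lborel. norm (f1 t * of_real (normal_density s (\<sigma> n) t)) \<le> norm (C * normal_density s (\<sigma> n) t)"
      using f1C C0 by (intro AE_I2) (simp add: norm_mult mult_right_mono)
  qed measurable
  have near: "(\<lambda>n. LINT t|lborel. f1 t * of_real (normal_density s (\<sigma> n) t)) \<longlonglongrightarrow> f s"
  proof -
    have "(LINT t|lborel. f1 t * of_real (normal_density s (\<sigma> n) t))
        = (LINT u|lborel. f1 (s + \<sigma> n * u) * of_real (std_normal_density u))" for n
      using \<sigma>(1)[of n]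
      by (subst lborel_integral_real_affine[of "\<sigma> n" _ s])
        (simp_all add: scaleR_conv_of_real normal_density_affine[symmetric, of "\<sigma> n" _ s] mult_ac
          flip: integral_mult_right_zero)
    moreover have "(\<lambda>n. LINT u|lborel. f1 (s + \<sigma> n * u) * of_real (std_normal_density u))
        \<longlonglongrightarrow> (LINT u|lborel. f s * of_real (std_normal_density u))"
    proof (rule integral_dominated_convergence)
      show "integrable lborel (\<lambda>u. C * std_normal_density u)" by simp
      show "AE u in lborel. norm (f1 (s + \<sigma> n * u) * of_real (std_normal_density u)) \<le> C * std_normal_density u" for n
        using f1C by (intro AE_I2) (simp add: norm_mult mult_right_mono)
      have "(\<lambda>n. f1 (s + \<sigma> n * u)) \<longlonglongrightarrow> f s" for u
      proof -
        have lim: "(\<lambda>n. s + \<sigma> n * u) \<longlonglongrightarrow> s + 0 * u" by (intro tendsto_intros \<sigma>)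
        have "isCont f s" using f(2) by (simp add: continuous_on_eq_continuous_at)
        then have "(\<lambda>n. f (s + \<sigma> n * u)) \<longlonglongrightarrow> f s"
          using lim by (intro isCont_tendsto_compose[of s f]) auto
        moreover have "eventually (\<lambda>n. dist (s + \<sigma> n * u) s < 1) sequentially"
          using lim by (intro tendstoD) auto
        then have "eventually (\<lambda>n. f (s + \<sigma> n * u) = f1 (s + \<sigma> n * u)) sequentially"
          by eventually_elim (auto simp: f1_def dist_real_def)
        ultimately show ?thesis by (rule Lim_transform_eventually)
      qed
      then show "AE u in lborel. (\<lambda>n. f1 (s + \<sigma> n * u) * of_real (std_normal_density u))
          \<longlonglongrightarrow> f s * of_real (std_normal_density u)"
        by (intro AE_I2 tendsto_intros)
    qed measurable
    moreover have "(LINT u|lborel. f s * of_real (std_normal_density u)) = f s"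
      by (simp add: integral_complex_of_real)
    ultimately show ?thesis by simp
  qed
  have "(LINT t|lborel. f t * of_real (normal_density s (\<sigma> n) t))
      = (LINT t|lborel. f1 t * of_real (normal_density s (\<sigma> n) t)) + (LINT t|lborel. f t * T n t)" for n
    unfolding Bochner_Integration.integral_add[OF near_int square_integrable_product[OF f(1) T(1)], symmetric]
    by (intro Bochner_Integration.integral_cong refl) (simp add: f1_def T_def)
  then show ?thesis using tendsto_add[OF near tail] by simp
qed

text \<open>Let the Gaussian weight tend to 1 in \<open>has_L2_fourier_gaussian_pairing\<close>. Integrability of \<open>g\<close> handles one
  side, continuity of \<open>f\<close> the other; it is what makes the formula hold at every point and not just almost
  everywhere.\<close>

lemma has_L2_fourier_inversion:
  assumes fg: "has_L2_fourier f g" and g: "integrable lborel g" and f: "continuous_on UNIV f"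
  shows "f s = (LINT v|lborel. g v * cis (2 * pi * s * v))"
proof -
  note [measurable] = borel_measurable_integrable[OF g]
  let ?a = "\<lambda>n. 1 / real (Suc n)"
  have sq: "square_integrable f"
    using fg by (auto simp: has_L2_fourier_def dest: L2_convergesD)
  have lim0: "?a \<longlonglongrightarrow> 0" by (rule LIMSEQ_Suc[OF lim_1_over_n])
  have "(\<lambda>n. ?a n / (2 * pi)) \<longlonglongrightarrow> 0 / (2 * pi)" by (intro tendsto_intros lim0) auto
  then have "(\<lambda>n. LINT t|lborel. f t * of_real (normal_density s (?a n / (2 * pi)) t)) \<longlonglongrightarrow> f s"
    by (intro gaussian_approximate_identity[OF sq f]) auto
  moreover have "(\<lambda>n. LINT v|lborel. g v * (of_real (exp (- (?a n * v)\<^sup>2 / 2)) * cis (2 * pi * s * v)))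
      \<longlonglongrightarrow> (LINT v|lborel. g v * cis (2 * pi * s * v))"
  proof (rule integral_dominated_convergence)
    show "integrable lborel (\<lambda>v. norm (g v))" using g by simp
    have "(\<lambda>n. g v * (of_real (exp (- (?a n * v)\<^sup>2 / 2)) * cis (2 * pi * s * v)))
        \<longlonglongrightarrow> g v * (of_real (exp (- (0 * v)\<^sup>2 / 2)) * cis (2 * pi * s * v))" for v
      by (intro tendsto_intros lim0) auto
    then show "AE v in lborel. (\<lambda>n. g v * (of_real (exp (- (?a n * v)\<^sup>2 / 2)) * cis (2 * pi * s * v)))
        \<longlonglongrightarrow> g v * cis (2 * pi * s * v)" by simp
    show "AE v in lborel. norm (g v * (of_real (exp (- (?a n * v)\<^sup>2 / 2)) * cis (2 * pi * s * v))) \<le> norm (g v)" for n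
      by (intro AE_I2) (simp add: norm_mult mult_left_le)
  qed measurable
  moreover have "0 < ?a n" for n by simp
  ultimately show ?thesis
    using has_L2_fourier_gaussian_pairing[OF fg, of "?a _" s] LIMSEQ_unique by simp
qed

section \<open>Sums of squares of sinc over an integer window\<close>

lemma Gamma_reflection_real:
  fixes z :: real
  shows "Gamma z * Gamma (1 - z) = pi / sin (pi * z)"
proof -
  have "complex_of_real (Gamma z * Gamma (1 - z)) = Gamma (of_real z) * Gamma (1 - of_real z)"
    by (simp flip: Gamma_complex_of_real)
  also have "\<dots> = complex_of_real (pi / sin (pi * z))"
    unfolding Gamma_reflection_complex by (simp flip: sin_of_real)
  finally show ?thesis by (simp only: of_real_eq_iff)
qed

lemma DERIV_unique_on_open:
  fixes f g :: "real \<Rightarrow> real"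
  assumes "open S" "z \<in> S" "\<And>x. x \<in> S \<Longrightarrow> f x = g x"
    and "(f has_field_derivative D) (at z)" "(g has_field_derivative E) (at z)"
  shows "D = E"
  using has_field_derivative_transform_within_open[OF assms(4,1,2,3)] assms(5) by (rule DERIV_unique)

text \<open>The logarithm of the reflection formula is differentiated twice.\<close>

lemma Polygamma_1_reflection_real:
  fixes z :: real
  assumes z: "0 < z" "z < 1"
  shows "Polygamma 1 z + Polygamma 1 (1 - z) = (pi / sin (pi * z))\<^sup>2"
proof -
  have sin_pos: "sin (pi * x) > 0" if "0 < x" "x < 1" for x :: real
    using that by (intro sin_gt_zero) auto
  have lnG: "ln_Gamma x + ln_Gamma (1 - x) = ln pi - ln (sin (pi * x))" if x: "0 < x" "x < 1" for x :: real
  proof -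
    have "ln_Gamma x + ln_Gamma (1 - x) = ln (Gamma x * Gamma (1 - x))"
      using x Gamma_real_pos[of x] Gamma_real_pos[of "1 - x"]
      by (subst ln_mult_pos) (auto simp: ln_Gamma_real_pos)
    also have "\<dots> = ln pi - ln (sin (pi * x))"
      unfolding Gamma_reflection_real using sin_pos[OF x] by (simp add: ln_div)
    finally show ?thesis .
  qed
  have nonpos: "x \<notin> \<int>\<^sub>\<le>\<^sub>0" if "0 < x" for x :: real
    using that by (auto elim!: nonpos_Ints_cases)
  have dig: "Digamma x - Digamma (1 - x) = - pi * cos (pi * x) / sin (pi * x)" if x: "0 < x" "x < 1" for x :: real
  proof (rule DERIV_unique_on_open[of "{0<..<1}"])
    show "((\<lambda>x. ln_Gamma x + ln_Gamma (1 - x)) has_field_derivative Digamma x - Digamma (1 - x)) (at x)"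
      using x by (auto intro!: derivative_eq_intros)
    show "((\<lambda>x. ln pi - ln (sin (pi * x))) has_field_derivative - pi * cos (pi * x) / sin (pi * x)) (at x)"
      using sin_pos[OF x] by (auto intro!: derivative_eq_intros)
  qed (use x lnG in auto)
  show ?thesis
  proof (rule DERIV_unique_on_open[of "{0<..<1}"])
    show "((\<lambda>x. Digamma x - Digamma (1 - x)) has_field_derivative Polygamma 1 z + Polygamma 1 (1 - z)) (at z)"
      using z nonpos[of z] nonpos[of "1 - z"] by (auto intro!: derivative_eq_intros)
    have eq: "- (pi * (pi * (sin (pi * z) * sin (pi * z)))) - pi * (pi * (cos (pi * z) * cos (pi * z))) = - (pi * pi)"
    proof -
      have "pi * (pi * (cos (pi * z) * cos (pi * z))) + pi * (pi * (sin (pi * z) * sin (pi * z)))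
          = pi * pi * ((sin (pi * z))\<^sup>2 + (cos (pi * z))\<^sup>2)"
        unfolding power2_eq_square distrib_left by (simp only: ac_simps)
      then show ?thesis unfolding sin_cos_squared_add mult_1_right by linarith
    qed
    show "((\<lambda>x. - pi * cos (pi * x) / sin (pi * x)) has_field_derivative (pi / sin (pi * z))\<^sup>2) (at z)"
      using sin_pos[OF z]
      by (auto intro!: derivative_eq_intros simp: power_divide power2_eq_square algebra_simps eq)
  qed (use z dig in auto)
qed

lemma summable_inverse_square_shift:
  "y > 0 \<Longrightarrow> summable (\<lambda>k. 1 / (y + real k)\<^sup>2)"
  using Polygamma_converges'[of y 2] by (simp add: inverse_eq_divide)

lemma suminf_inverse_square_reflection:
  fixes z :: real
  assumes z: "0 < z" "z < 1"
  shows "(\<Sum>k. 1 / (z + real k)\<^sup>2) + (\<Sum>k. 1 / (1 - z + real k)\<^sup>2) = (pi / sin (pi * z))\<^sup>2"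
  using Polygamma_1_reflection_real[OF z] by (simp add: Polygamma_def inverse_eq_divide power2_eq_square)

text \<open>Each term is at most \<open>1/(y + k - 1/2) - 1/(y + k + 1/2)\<close>, and these telescope. The half-integer shift is
  what makes the bound sharp enough: comparing with \<open>1/(y + k - 1) - 1/(y + k)\<close> would lose the constant
  in \<open>tail_inverse_squares_le\<close>.\<close>

lemma suminf_inverse_square_le:
  fixes y :: real
  assumes y: "y > 1/2"
  shows "(\<Sum>k. 1 / (y + real k)\<^sup>2) \<le> 1 / (y - 1/2)"
proof -
  let ?t = "\<lambda>k. 1 / (y - 1/2 + real k)"
  have "?t \<longlonglongrightarrow> 0"
    by (intro tendsto_divide_0[OF tendsto_const] filterlim_at_top_imp_at_infinity
        filterlim_tendsto_add_at_top[OF tendsto_const] filterlim_real_sequentially)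
  then have sums: "(\<lambda>k. ?t k - ?t (Suc k)) sums (?t 0 - 0)" by (rule telescope_sums')
  have le: "1 / (y + real k)\<^sup>2 \<le> ?t k - ?t (Suc k)" for k
  proof -
    have pos: "0 < y - 1/2 + real k" "0 < y + 1/2 + real k" using y by auto
    have "?t k - ?t (Suc k) = 1 / ((y - 1/2 + real k) * (y + 1/2 + real k))"
      using pos by (simp add: field_simps)
    moreover have "(y - 1/2 + real k) * (y + 1/2 + real k) \<le> (y + real k)\<^sup>2"
      by (simp add: power2_eq_square algebra_simps)
    ultimately show ?thesis using pos by (auto intro!: divide_left_mono mult_pos_pos)
  qed
  have "(\<Sum>k. 1 / (y + real k)\<^sup>2) \<le> (\<Sum>k. ?t k - ?t (Suc k))"
    using y by (intro suminf_le le summable_inverse_square_shift sums_summable[OF sums]) auto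
  then show ?thesis using sums_unique[OF sums] by simp
qed

text \<open>For \<open>x = n + z\<close> the distances from \<open>x\<close> to the integers are \<open>z + k\<close> on one side and \<open>1 - z + k\<close> on the
  other, so the left-hand side collects the integers beyond the nearest \<open>m\<close> on each side. The bound from
  telescoping is a convex function of \<open>z\<close>, symmetric about \<open>1/2\<close>, hence largest as \<open>z\<close> approaches 0 or 1,
  where it equals \<open>1/(m - 1/2) + 1/(m + 1/2)\<close>.\<close>

lemma tail_inverse_squares_le:
  fixes z :: real
  assumes z: "0 < z" "z < 1" and m: "m \<ge> (1::nat)"
  shows "(pi / sin (pi * z))\<^sup>2 - (\<Sum>k<m. 1 / (z + real k)\<^sup>2 + 1 / (1 - z + real k)\<^sup>2)
    \<le> 2 / real m + 1 / (real m)\<^sup>2"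
proof -
  have split: "(\<Sum>k. 1 / (y + real k)\<^sup>2) - (\<Sum>k<m. 1 / (y + real k)\<^sup>2) = (\<Sum>k. 1 / ((y + real m) + real k)\<^sup>2)"
    if "y > 0" for y :: real
    using suminf_split_initial_segment[OF summable_inverse_square_shift[OF that], of m]
    by (simp add: add_ac)
  have "(pi / sin (pi * z))\<^sup>2 - (\<Sum>k<m. 1 / (z + real k)\<^sup>2 + 1 / (1 - z + real k)\<^sup>2)
      = (\<Sum>k. 1 / ((z + real m) + real k)\<^sup>2) + (\<Sum>k. 1 / ((1 - z + real m) + real k)\<^sup>2)"
    using z split[of z] split[of "1 - z"]
    unfolding suminf_inverse_square_reflection[OF z, symmetric] sum.distrib by simp
  also have "\<dots> \<le> 1 / (z + real m - 1/2) + 1 / (1 - z + real m - 1/2)"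
    using z m by (intro add_mono suminf_inverse_square_le) auto
  also have "\<dots> = 2 * real m / ((z + real m - 1/2) * (1 - z + real m - 1/2))"
    using z m by (subst add_frac_eq) (auto simp: algebra_simps)
  also have "\<dots> \<le> 2 * real m / ((real m - 1/2) * (real m + 1/2))"
  proof (intro divide_left_mono mult_pos_pos)
    have "0 \<le> z * (1 - z)" using z by simp
    moreover have "(z + real m - 1/2) * (1 - z + real m - 1/2)
        = (real m - 1/2) * (real m + 1/2) + z * (1 - z)"
      by (simp add: field_simps)
    ultimately show "(real m - 1/2) * (real m + 1/2) \<le> (z + real m - 1/2) * (1 - z + real m - 1/2)"
      by simp
  qed (use z m in auto)
  also have "\<dots> \<le> (2 * real m + 1) / (real m)\<^sup>2"
  proof (subst frac_le_eq)
    have "real m * 1 \<le> real m * real m" "real m \<ge> 1" using m by (auto intro!: mult_left_mono)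
    then have "1/4 + real m / 2 \<le> real m * real m" by linarith
    then have "2 * real m * (real m)\<^sup>2 - (2 * real m + 1) * ((real m - 1/2) * (real m + 1/2)) \<le> 0"
      using m by (simp add: power2_eq_square algebra_simps)
    then show "(2 * real m * (real m)\<^sup>2 - (2 * real m + 1) * ((real m - 1/2) * (real m + 1/2)))
        / ((real m - 1/2) * (real m + 1/2) * (real m)\<^sup>2) \<le> 0"
      using m by (intro divide_nonpos_nonneg mult_nonneg_nonneg) auto
  qed (use m in auto)
  also have "\<dots> = 2 / real m + 1 / (real m)\<^sup>2"
    using m by (simp add: power2_eq_square field_simps)
  finally show ?thesis .
qed

lemma sin_pi_int_shift_power2: "(sin (pi * (x - of_int l)))\<^sup>2 = (sin (pi * x))\<^sup>2"
proof -
  have s: "sin (pi * of_int l) = 0" by (simp add: sin_zero_iff_int2)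
  then have "(cos (pi * of_int l))\<^sup>2 = 1" using sin_cos_squared_add[of "pi * of_int l"] by simp
  then show ?thesis by (simp add: right_diff_distrib sin_diff s power_mult_distrib)
qed

lemma finite_int_window: "finite {l::int. \<bar>x - of_int l\<bar> \<le> real m}"
proof (rule finite_subset)
  show "{l::int. \<bar>x - of_int l\<bar> \<le> real m} \<subseteq> {\<lfloor>x - real m\<rfloor>..\<lceil>x + real m\<rceil>}"
    by (auto simp: abs_le_iff floor_le_iff le_ceiling_iff)
qed simp

text \<open>The squares \<open>sinc\<^sup>2 (\<pi> (x - l))\<close> over all integers \<open>l\<close> add up to 1. If \<open>x\<close> is an integer, the term \<open>l = x\<close>
  alone is 1. Otherwise all numerators equal \<open>sin\<^sup>2 (\<pi> x)\<close>, and \<open>tail_inverse_squares_le\<close> applies with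
  the fractional part of \<open>x\<close>.\<close>

lemma sinc_tail_le:
  fixes x :: real
  assumes m: "m \<ge> (1::nat)"
  shows "1 - (\<Sum>l\<in>{l::int. \<bar>x - of_int l\<bar> \<le> real m}. (sinc (pi * (x - of_int l)))\<^sup>2)
    \<le> (2 / real m + 1 / (real m)\<^sup>2) / pi\<^sup>2"
proof -
  let ?I = "{l::int. \<bar>x - of_int l\<bar> \<le> real m}"
  define c where "c l = (sinc (pi * (x - of_int l)))\<^sup>2" for l :: int
  have c0: "c l \<ge> 0" for l by (simp add: c_def)
  show ?thesis
  proof (cases "x \<in> \<int>")
    case True
    then obtain n where n: "x = of_int n" by (auto elim: Ints_cases)
    have "c n \<le> (\<Sum>l\<in>?I. c l)"
      using finite_int_window[of x m] c0 by (intro member_le_sum) (auto simp: n)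
    moreover have "c n = 1" by (simp add: c_def n)
    ultimately have "1 - (\<Sum>l\<in>?I. c l) \<le> 0" by simp
    also have "0 \<le> (2 / real m + 1 / (real m)\<^sup>2) / pi\<^sup>2" by simp
    finally show ?thesis unfolding c_def .
  next
    case False
    define n z where "n = \<lfloor>x\<rfloor>" and "z = x - of_int n"
    have z: "0 < z" "z < 1"
    proof -
      show "z < 1" unfolding z_def n_def by linarith
      have "z \<noteq> 0" using False by (auto simp: z_def)
      moreover have "z \<ge> 0" unfolding z_def n_def by simp
      ultimately show "0 < z" by simp
    qed
    have S: "(sin (pi * x))\<^sup>2 = (sin (pi * z))\<^sup>2"
      unfolding z_def by (rule sin_pi_int_shift_power2[symmetric])
    have c_eq: "c l = (sin (pi * z) / pi)\<^sup>2 * (1 / (x - of_int l)\<^sup>2)" for l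
    proof -
      have "x - of_int l \<noteq> 0" using False by auto
      then have "c l = (sin (pi * (x - of_int l)))\<^sup>2 / (pi\<^sup>2 * (x - of_int l)\<^sup>2)"
        by (simp add: c_def power_divide power_mult_distrib)
      then show ?thesis unfolding sin_pi_int_shift_power2 S by (simp add: power_divide)
    qed
    \<comment> \<open>The \<open>m\<close> nearest integers below and above \<open>x\<close> all lie in the window.\<close>
    let ?A = "(\<lambda>k. n - int k) ` {..<m}" and ?B = "(\<lambda>k. n + 1 + int k) ` {..<m}"
    have "(\<Sum>k<m. 1 / (z + real k)\<^sup>2 + 1 / (1 - z + real k)\<^sup>2) * (sin (pi * z) / pi)\<^sup>2
        = (\<Sum>k<m. c (n - int k)) + (\<Sum>k<m. c (n + 1 + int k))"
    proof -
      have "1 / (z + real k)\<^sup>2 * (sin (pi * z) / pi)\<^sup>2 = c (n - int k)" for k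
        unfolding c_eq z_def by (simp add: algebra_simps)
      moreover have "1 / (1 - z + real k)\<^sup>2 * (sin (pi * z) / pi)\<^sup>2 = c (n + 1 + int k)" for k
        unfolding c_eq using power2_commute[of "1 - z + real k" 0]
          power2_commute[of "x" "of_int (n + 1 + int k)"]
        by (simp add: z_def algebra_simps)
      ultimately show ?thesis by (simp add: sum_distrib_right distrib_right sum.distrib)
    qed
    also have "\<dots> = sum c ?A + sum c ?B"
      by (simp add: sum.reindex inj_on_def)
    also have "\<dots> = sum c (?A \<union> ?B)"
      by (rule sum.union_disjoint[symmetric]) auto
    also have "\<dots> \<le> sum c ?I"
      using z finite_int_window[of x m] c0 by (intro sum_mono2) (auto simp: z_def abs_le_iff)
    finally have "1 - sum c ?I \<le> 1 - (\<Sum>k<m. 1 / (z + real k)\<^sup>2 + 1 / (1 - z + real k)\<^sup>2) * (sin (pi * z) / pi)\<^sup>2"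
      by simp
    also have "\<dots> = ((pi / sin (pi * z))\<^sup>2 - (\<Sum>k<m. 1 / (z + real k)\<^sup>2 + 1 / (1 - z + real k)\<^sup>2)) * (sin (pi * z) / pi)\<^sup>2"
    proof -
      have "sin (pi * z) > 0" using z by (intro sin_gt_zero) auto
      then have "(pi / sin (pi * z))\<^sup>2 * (sin (pi * z) / pi)\<^sup>2 = 1"
        by (simp flip: power_mult_distrib)
      then show ?thesis by (simp add: left_diff_distrib)
    qed
    also have "\<dots> \<le> (2 / real m + 1 / (real m)\<^sup>2) * (1 / pi\<^sup>2)"
    proof (intro mult_mono tail_inverse_squares_le z m)
      show "(sin (pi * z) / pi)\<^sup>2 \<le> 1 / pi\<^sup>2"
        by (simp add: power_divide divide_right_mono power_le_one abs_square_le_1)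
    qed auto
    finally show ?thesis unfolding c_def by simp
  qed
qed

section \<open>Approximating an exponential by its neighbours\<close>

lemma has_integral_cos_window:
  fixes \<alpha> L :: real
  assumes L: "L > 0"
  shows "has_bochner_integral lborel (\<lambda>v. cos (\<alpha> * v) * indicator {- (L/2)..L/2} v) (L * sinc (\<alpha> * L / 2))"
proof (cases "\<alpha> = 0")
  case True
  have "has_bochner_integral lborel (\<lambda>v. 1 * indicator {- (L/2)..L/2} v :: real) (L/2 - (- (L/2)))"
    using L by (intro has_bochner_integral_FTC_Icc_real[where F="\<lambda>v. v"]) (auto intro!: derivative_eq_intros)
  then show ?thesis using True by simp
next
  case False
  have "has_bochner_integral lborel (\<lambda>v. cos (\<alpha> * v) * indicator {- (L/2)..L/2} v)
      (sin (\<alpha> * (L/2)) / \<alpha> - sin (\<alpha> * (- (L/2))) / \<alpha>)"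
    using L False
    by (intro has_bochner_integral_FTC_Icc_real[where F="\<lambda>v. sin (\<alpha> * v) / \<alpha>"])
      (auto intro!: derivative_eq_intros continuous_intros)
  then show ?thesis using False L by (simp add: mult.commute[of 2])
qed

lemma norm_cis_minus_sum_power2:
  fixes c b :: "'i \<Rightarrow> real"
  shows "(norm (cis a - (\<Sum>l\<in>I. of_real (c l) * cis (b l))))\<^sup>2
    = 1 - 2 * (\<Sum>l\<in>I. c l * cos (a - b l)) + (\<Sum>l\<in>I. \<Sum>k\<in>I. c l * c k * cos (b l - b k))"
proof -
  let ?C = "\<Sum>l\<in>I. c l * cos (b l)" and ?S = "\<Sum>l\<in>I. c l * sin (b l)"
  have "(norm (cis a - (\<Sum>l\<in>I. of_real (c l) * cis (b l))))\<^sup>2 = (cos a - ?C)\<^sup>2 + (sin a - ?S)\<^sup>2"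
    by (simp add: cmod_power2)
  also have "\<dots> = ((cos a)\<^sup>2 + (sin a)\<^sup>2) - 2 * (cos a * ?C + sin a * ?S) + (?C * ?C + ?S * ?S)"
    by (simp add: power2_eq_square algebra_simps)
  also have "cos a * ?C + sin a * ?S = (\<Sum>l\<in>I. c l * cos (a - b l))"
    by (simp add: cos_diff sum_distrib_left distrib_left sum.distrib mult_ac)
  also have "?C * ?C + ?S * ?S = (\<Sum>l\<in>I. \<Sum>k\<in>I. c l * c k * cos (b l - b k))"
    by (simp add: cos_diff sum_product distrib_left sum.distrib mult_ac)
  finally show ?thesis by simp
qed

lemma sinc_pi_int: "sinc (pi * of_int n) = (if n = 0 then 1 else 0)"
  by (simp add: sin_zero_iff_int2)

text \<open>With \<open>x = L t\<close>, this is the error made on the frequency band \<open>[-L/2, L/2]\<close> when \<open>exp (2\<pi>i t v)\<close> is replaced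
  by its sampling sum over \<open>I\<close>. Pairing it with the Fourier transform of a band-limited function gives the
  error of the sampling formula at \<open>t\<close>.\<close>

definition sampling_residual :: "real \<Rightarrow> int set \<Rightarrow> real \<Rightarrow> real \<Rightarrow> complex" where
  "sampling_residual L I x v = indicator {- (L/2)..L/2} v *\<^sub>R
     (cis (2 * pi * (x / L) * v) -
      (\<Sum>l\<in>I. of_real (sinc (pi * (x - of_int l))) * cis (2 * pi * (of_int l / L) * v)))"

text \<open>On \<open>[-L/2, L/2]\<close>, two exponentials of frequencies \<open>x/L\<close> and \<open>y/L\<close> have inner product
  \<open>L sinc (\<pi> (x - y))\<close>. For integers \<open>x\<close> and \<open>y\<close> this is \<open>L\<close> or 0, and for \<open>y = l\<close> it is \<open>L\<close> times the
  coefficient of the \<open>l\<close>-th exponential. Expanding the square hence gives \<open>L - 2 L \<Sum> c\<^sub>l\<^sup>2 + L \<Sum> c\<^sub>l\<^sup>2\<close>.\<close>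

lemma
  fixes L :: real
  assumes L: "L > 0" and I: "finite I"
  shows square_integrable_sampling_residual: "square_integrable (sampling_residual L I x)"
    and L2_norm_sampling_residual: "(L2_norm_real (sampling_residual L I x))\<^sup>2
      = L * (1 - (\<Sum>l\<in>I. (sinc (pi * (x - of_int l)))\<^sup>2))"
proof -
  define c where "c l = sinc (pi * (x - of_int l))" for l :: int
  define w where "w \<alpha> v = cos (\<alpha> * v) * indicator {- (L/2)..L/2} v" for \<alpha> v :: real
  have w: "has_bochner_integral lborel (w \<alpha>) (L * sinc (\<alpha> * L / 2))" for \<alpha>
    unfolding w_def using has_integral_cos_window[OF L] .
  have "has_bochner_integral lborel
      (\<lambda>v. w 0 v - 2 * (\<Sum>l\<in>I. c l * w (2 * pi * (x - of_int l) / L) v)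
        + (\<Sum>l\<in>I. \<Sum>k\<in>I. c l * c k * w (2 * pi * (of_int l - of_int k) / L) v))
      (L * sinc (0 * L / 2) - 2 * (\<Sum>l\<in>I. c l * (L * sinc (2 * pi * (x - of_int l) / L * L / 2)))
        + (\<Sum>l\<in>I. \<Sum>k\<in>I. c l * c k * (L * sinc (2 * pi * (of_int l - of_int k) / L * L / 2))))"
    by (intro has_bochner_integral_add has_bochner_integral_diff has_bochner_integral_mult_right
        has_bochner_integral_sum w)
  also have "(\<lambda>v. w 0 v - 2 * (\<Sum>l\<in>I. c l * w (2 * pi * (x - of_int l) / L) v)
        + (\<Sum>l\<in>I. \<Sum>k\<in>I. c l * c k * w (2 * pi * (of_int l - of_int k) / L) v))
      = (\<lambda>v. (norm (sampling_residual L I x v))\<^sup>2)"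
  proof
    fix v
    have a: "2 * pi * (x / L) * v - 2 * pi * (of_int l / L) * v = 2 * pi * (x - of_int l) / L * v" for l
      by (simp add: diff_divide_distrib algebra_simps)
    have b: "2 * pi * (of_int l / L) * v - 2 * pi * (of_int k / L) * v = 2 * pi * (of_int l - of_int k) / L * v" for l k
      by (simp add: diff_divide_distrib algebra_simps)
    show "w 0 v - 2 * (\<Sum>l\<in>I. c l * w (2 * pi * (x - of_int l) / L) v)
        + (\<Sum>l\<in>I. \<Sum>k\<in>I. c l * c k * w (2 * pi * (of_int l - of_int k) / L) v)
      = (norm (sampling_residual L I x v))\<^sup>2"
    proof (cases "v \<in> {- (L/2)..L/2}")
      case True
      then have "sampling_residual L I x v =
          cis (2 * pi * (x / L) * v) - (\<Sum>l\<in>I. of_real (c l) * cis (2 * pi * (of_int l / L) * v))"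
        unfolding sampling_residual_def c_def by simp
      then have "(norm (sampling_residual L I x v))\<^sup>2
          = 1 - 2 * (\<Sum>l\<in>I. c l * cos (2 * pi * (x - of_int l) / L * v))
            + (\<Sum>l\<in>I. \<Sum>k\<in>I. c l * c k * cos (2 * pi * (of_int l - of_int k) / L * v))"
        unfolding norm_cis_minus_sum_power2[symmetric] a[symmetric] b[symmetric]
        by (simp only: norm_cis_minus_sum_power2)
      then show ?thesis using True by (simp add: w_def)
    qed (simp_all add: sampling_residual_def w_def)
  qed
  also have "L * sinc (0 * L / 2) - 2 * (\<Sum>l\<in>I. c l * (L * sinc (2 * pi * (x - of_int l) / L * L / 2)))
        + (\<Sum>l\<in>I. \<Sum>k\<in>I. c l * c k * (L * sinc (2 * pi * (of_int l - of_int k) / L * L / 2)))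
      = L * (1 - (\<Sum>l\<in>I. (c l)\<^sup>2))"
  proof -
    have half: "2 * pi * y / L * L / 2 = pi * y" for y using L by simp
    have "sinc (pi * (of_int l - of_int k)) = (if l = k then 1 else 0)" for l k
      using sinc_pi_int[of "l - k", unfolded of_int_diff] by simp
    then have "(\<Sum>l\<in>I. \<Sum>k\<in>I. c l * c k * (L * sinc (pi * (of_int l - of_int k))))
        = (\<Sum>l\<in>I. \<Sum>k\<in>I. if l = k then c l * c k * L else 0)"
      by (intro sum.cong refl) simp
    also have "\<dots> = (\<Sum>l\<in>I. L * (c l)\<^sup>2)"
      using I by (simp add: power2_eq_square mult_ac)
    finally show ?thesis
      unfolding half c_def[symmetric]
      by (simp add: sum_distrib_left[symmetric] power2_eq_square algebra_simps)
  qed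
  finally have H: "has_bochner_integral lborel (\<lambda>v. (norm (sampling_residual L I x v))\<^sup>2)
      (L * (1 - (\<Sum>l\<in>I. (c l)\<^sup>2)))" .
  have "sampling_residual L I x \<in> borel_measurable lborel"
    unfolding sampling_residual_def[abs_def] by measurable
  with H show "square_integrable (sampling_residual L I x)"
    by (simp add: square_integrable_def has_bochner_integral_iff)
  show "(L2_norm_real (sampling_residual L I x))\<^sup>2 = L * (1 - (\<Sum>l\<in>I. (sinc (pi * (x - of_int l)))\<^sup>2))"
    using H by (simp add: L2_norm_real_power2 has_bochner_integral_iff c_def)
qed

section \<open>Functions in the Paley--Wiener space\<close>

lemma smooth_fun_continuous:
  assumes "smooth_fun f"
  shows "continuous_on UNIV f"
proof -
  obtain D where D: "D 0 = f" "\<And>n t. (D n has_vector_derivative D (Suc n) t) (at t)"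
    using assms unfolding smooth_fun_def by blast
  show ?thesis
    using has_vector_derivative_continuous[OF D(2)[of 0]]
    by (auto simp: D(1) intro: continuous_at_imp_continuous_on)
qed

text \<open>The open sets on which \<open>g\<close> vanishes almost everywhere may be uncountably many; by Lindelof's theorem
  countably many of them already cover the same set, and then the null sets can be united.\<close>

lemma AE_zero_outside_ess_support: "AE v in lborel. v \<notin> ess_support g \<longrightarrow> g v = 0"
proof -
  let ?\<U> = "{U. open U \<and> (AE v in lborel. v \<in> U \<longrightarrow> g v = 0)}"
  obtain \<V> where \<V>: "\<V> \<subseteq> ?\<U>" "countable \<V>" "\<Union>\<V> = \<Union>?\<U>"
    using Lindelof[of ?\<U>] by auto
  have "AE v in lborel. \<forall>U\<in>\<V>. v \<in> U \<longrightarrow> g v = 0"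
    using \<V> by (intro AE_ball_countable') auto
  then show ?thesis
    by eventually_elim (use \<V>(3) in \<open>auto simp: ess_support_def\<close>)
qed

text \<open>The transform is changed on a null set so that it vanishes everywhere off the band. It is then
  integrable, being a product of two square integrable functions, which is what inversion asks for.\<close>

lemma paley_wiener_representation:
  assumes f: "f \<in> paley_wiener \<delta>"
  obtains g where "square_integrable g" "integrable lborel g" "\<And>v. v \<notin> {-\<delta>..\<delta>} \<Longrightarrow> g v = 0"
    "L2_norm_real g \<le> L2_norm_real f" "\<And>s. f s = (LINT v|lborel. g v * cis (2 * pi * s * v))"
proof -
  obtain g0 where g0: "has_L2_fourier f g0" "ess_support g0 \<subseteq> {-\<delta>..\<delta>}" and sm: "smooth_fun f"
    using f by (auto simp: paley_wiener_def)
  have sq: "square_integrable g0"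
    using g0(1) by (auto simp: has_L2_fourier_def dest: L2_convergesD)
  then have [measurable]: "g0 \<in> borel_measurable lborel" by (simp add: square_integrable_def)
  define g where "g v = g0 v * indicator {-\<delta>..\<delta>} v" for v
  have [measurable]: "g \<in> borel_measurable lborel" unfolding g_def[abs_def] by measurable
  have ae: "AE v in lborel. g v = g0 v"
    using AE_zero_outside_ess_support[of g0]
    by eventually_elim (use g0(2) in \<open>auto simp: g_def indicator_def\<close>)
  have ind: "square_integrable (indicator {-\<delta>..\<delta>})"
  proof -
    have "integrable lborel (indicator {-\<delta>..\<delta>} :: real \<Rightarrow> complex)"
      by (intro integrable_real_indicator[THEN integrable_of_real, where 'a=complex, unfolded of_real_indicator]) 
         (auto simp: emeasure_lborel_Icc_eq)
    then show ?thesis by (rule square_integrable_bounded[of _ 1]) (auto simp: indicator_def)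
  qed
  have int: "integrable lborel g"
    unfolding g_def[abs_def] by (rule square_integrable_product[OF sq ind])
  have int0: "integrable lborel g0"
    using int ae by (subst integrable_cong_AE[of _ _ g]) auto
  have ae2: "AE v in lborel. (norm (g v))\<^sup>2 = (norm (g0 v))\<^sup>2"
    using ae by eventually_elim simp
  show ?thesis
  proof
    show "square_integrable g"
      unfolding square_integrable_def
    proof
      show "integrable lborel (\<lambda>v. (norm (g v))\<^sup>2)"
        using sq by (subst integrable_cong_AE[OF _ _ ae2]) (simp_all add: square_integrable_def)
    qed measurable
    show "integrable lborel g" by (rule int)
    show "g v = 0" if "v \<notin> {-\<delta>..\<delta>}" for v using that by (simp add: g_def)
    have "L2_norm_real g = L2_norm_real g0"
      unfolding L2_norm_real_def by (subst integral_cong_AE[OF _ _ ae2]) simp_all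
    then show "L2_norm_real g \<le> L2_norm_real f"
      using has_L2_fourier_norm_le[OF g0(1)] by simp
    have "(LINT v|lborel. g v * cis (2 * pi * s * v)) = (LINT v|lborel. g0 v * cis (2 * pi * s * v))" for s
    proof (rule integral_cong_AE)
      show "AE v in lborel. g v * cis (2 * pi * s * v) = g0 v * cis (2 * pi * s * v)"
        using ae by eventually_elim simp
    qed measurable
    then show "f s = (LINT v|lborel. g v * cis (2 * pi * s * v))" for s
      using has_L2_fourier_inversion[OF g0(1) int0 smooth_fun_continuous[OF sm]] by simp
  qed
qed

section \<open>The truncated sampling formula\<close>

lemma sampling_window_iff:
  assumes L: "L > 0"
  shows "t - of_int l / L \<in> {- (real m / L)..real m / L} \<longleftrightarrow> \<bar>L * t - of_int l\<bar> \<le> real m"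
proof -
  have "t - of_int l / L = (L * t - of_int l) / L"
    using L by (simp add: diff_divide_distrib)
  then show ?thesis
    using L pos_minus_divide_le_eq[of L "real m" "(L * t - of_int l) / L"]
      pos_le_divide_eq[of L "- real m" "L * t - of_int l"]
    by (auto simp: divide_le_cancel abs_le_iff)
qed

text \<open>The indicator is kept so that \<open>J\<close> may be larger than the window at \<open>t\<close>. This allows one index set to serve
  all \<open>t\<close> in a neighbourhood, and an index set of known size to be chosen.\<close>

lemma R_rect_eq_sum:
  assumes L: "L > 0" and J: "finite J" "{l::int. \<bar>L * t - of_int l\<bar> \<le> real m} \<subseteq> J"
  shows "R_rect L m f t = (\<Sum>l\<in>J. f (of_int l / L) * of_real (sinc (pi * (L * t - of_int l)))
    * indicator {- (real m / L)..real m / L} (t - of_int l / L))"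
proof -
  have arg: "L * pi * (t - of_int l / L) = pi * (L * t - of_int l)" for l
    using L by (simp add: field_simps)
  have "t - of_int l / L \<notin> {- (real m / L)..real m / L}" if "l \<notin> J" for l
    unfolding sampling_window_iff[OF L] using that J by auto
  then have "R_rect L m f t = infsum (\<lambda>l. f (of_int l / L) * of_real (sinc (pi * (L * t - of_int l)))
    * indicator {- (real m / L)..real m / L} (t - of_int l / L)) J"
    unfolding R_rect_def arg by (intro infsum_cong_neutral) auto
  then show ?thesis using J by simp
qed

lemma R_rect_eq_window_sum:
  assumes L: "L > 0"
  shows "R_rect L m f t
    = (\<Sum>l\<in>{l::int. \<bar>L * t - of_int l\<bar> \<le> real m}. f (of_int l / L) * of_real (sinc (pi * (L * t - of_int l))))"
  unfolding R_rect_eq_sum[OF L finite_int_window order_refl]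
proof (intro sum.cong refl)
  fix l :: int assume "l \<in> {l::int. \<bar>L * t - of_int l\<bar> \<le> real m}"
  then have "t - of_int l / L \<in> {- (real m / L)..real m / L}"
    unfolding sampling_window_iff[OF L] by simp
  then show "f (of_int l / L) * of_real (sinc (pi * (L * t - of_int l)))
      * indicator {- (real m / L)..real m / L} (t - of_int l / L)
    = f (of_int l / L) * of_real (sinc (pi * (L * t - of_int l)))" by simp
qed

text \<open>The error at \<open>t\<close> is the pairing of the transform of \<open>f\<close> with \<open>sampling_residual\<close> at \<open>x = L t\<close>; the band
  condition \<open>\<delta> \<le> L / 2\<close> is what lets the residual be cut off outside \<open>[-L/2, L/2]\<close>.\<close>

lemma paley_wiener_R_rect_error:
  assumes f: "f \<in> paley_wiener \<delta>" and \<delta>: "\<delta> \<le> L / 2" and L: "L > 0" and m: "m \<ge> 1"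
  shows "norm (f t - R_rect L m f t) \<le> sqrt L / pi * sqrt (2 / real m + 1 / (real m)\<^sup>2) * L2_norm_real f"
proof -
  obtain g where g: "square_integrable g" "integrable lborel g" "\<And>v. v \<notin> {-\<delta>..\<delta>} \<Longrightarrow> g v = 0"
    "L2_norm_real g \<le> L2_norm_real f" "\<And>s. f s = (LINT v|lborel. g v * cis (2 * pi * s * v))"
    using paley_wiener_representation[OF f] by blast
  note [measurable] = borel_measurable_integrable[OF g(2)]
  define I where "I = {l::int. \<bar>L * t - of_int l\<bar> \<le> real m}"
  have I: "finite I" unfolding I_def by (rule finite_int_window)
  let ?c = "\<lambda>l. complex_of_real (sinc (pi * (L * t - of_int l)))"
  let ?K = "sampling_residual L I (L * t)"
  have gcis: "integrable lborel (\<lambda>v. g v * cis (2 * pi * s * v))" for s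
    using g(2) by (intro integrable_mult_cis) auto
  have gccis: "integrable lborel (\<lambda>v. g v * cis (2 * pi * s * v) * z)" for s z
    using gcis[of s] by simp
  have "f t - R_rect L m f t
      = (LINT v|lborel. g v * cis (2 * pi * t * v))
        - (\<Sum>l\<in>I. LINT v|lborel. g v * cis (2 * pi * (of_int l / L) * v) * ?c l)"
    unfolding R_rect_eq_window_sum[OF L] I_def[symmetric] g(5) integral_mult_left_zero ..
  also have "\<dots> = (LINT v|lborel. g v * cis (2 * pi * t * v)
        - (\<Sum>l\<in>I. g v * cis (2 * pi * (of_int l / L) * v) * ?c l))"
    using gcis gccis by (simp only: Bochner_Integration.integral_diff Bochner_Integration.integral_sum
        Bochner_Integration.integrable_sum)
  also have "\<dots> = (LINT v|lborel. g v * ?K v)"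
  proof (intro Bochner_Integration.integral_cong refl)
    fix v
    show "g v * cis (2 * pi * t * v) - (\<Sum>l\<in>I. g v * cis (2 * pi * (of_int l / L) * v) * ?c l) = g v * ?K v"
    proof (cases "v \<in> {-\<delta>..\<delta>}")
      case True
      then have "?K v = cis (2 * pi * t * v) - (\<Sum>l\<in>I. ?c l * cis (2 * pi * (of_int l / L) * v))"
        using \<delta> L unfolding sampling_residual_def by simp
      then show ?thesis by (simp only: right_diff_distrib sum_distrib_left mult_ac)
    qed (simp add: g(3))
  qed
  finally have "norm (f t - R_rect L m f t) \<le> L2_norm_real g * L2_norm_real ?K"
    using Cauchy_Schwarz_L2[OF g(1) square_integrable_sampling_residual[OF L I]] by simp
  also have "\<dots> \<le> L2_norm_real f * (sqrt L / pi * sqrt (2 / real m + 1 / (real m)\<^sup>2))"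
  proof (intro mult_mono g(4) L2_norm_real_nonneg)
    have "(L2_norm_real ?K)\<^sup>2 = L * (1 - (\<Sum>l\<in>I. (sinc (pi * (L * t - of_int l)))\<^sup>2))"
      by (rule L2_norm_sampling_residual[OF L I])
    also have "\<dots> \<le> L * ((2 / real m + 1 / (real m)\<^sup>2) / pi\<^sup>2)"
      unfolding I_def by (intro mult_left_mono sinc_tail_le m less_imp_le[OF L])
    finally have "L2_norm_real ?K \<le> sqrt (L * ((2 / real m + 1 / (real m)\<^sup>2) / pi\<^sup>2))"
      by (rule real_le_rsqrt)
    then show "L2_norm_real ?K \<le> sqrt L / pi * sqrt (2 / real m + 1 / (real m)\<^sup>2)"
      by (simp add: real_sqrt_mult real_sqrt_divide)
  qed
  finally show ?thesis by (simp add: mult_ac)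
qed

section \<open>Continuity and decay of the error\<close>

text \<open>If \<open>|f(t)| \<ge> e\<close>, the Lipschitz bound keeps \<open>|f| \<ge> e/2\<close> on an interval whose length does not depend on
  \<open>t\<close>. Far out this would contradict that the tails of \<open>\<integral> |f|\<^sup>2\<close> tend to 0.\<close>

lemma Lipschitz_square_integrable_tendsto_0:
  assumes f: "square_integrable f" and M: "\<And>s t. norm (f s - f t) \<le> M * \<bar>s - t\<bar>"
  shows "(f \<longlongrightarrow> 0) at_infinity"
  unfolding Lim_at_infinity dist_norm
proof (intro allI impI)
  fix e :: real assume e: "e > 0"
  have [measurable]: "f \<in> borel_measurable lborel" and int: "integrable lborel (\<lambda>t. (norm (f t))\<^sup>2)"
    using f by (auto simp: square_integrable_def)
  have M0: "M \<ge> 0" using order_trans[OF norm_ge_zero M[of 1 0]] by simp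
  \<comment> \<open>The length of the interval; \<open>M + 1\<close> guards against \<open>M = 0\<close>.\<close>
  define d where "d = e / (2 * (M + 1))"
  have d: "d > 0" "M * d \<le> e / 2"
    using e M0 by (auto simp: d_def field_simps)
  define \<tau> where "\<tau> n = (LINT t|lborel. indicator {t. real n \<le> \<bar>t\<bar>} t * (norm (f t))\<^sup>2)" for n :: nat
  have "\<tau> \<longlonglongrightarrow> (LINT t::real|lborel. 0)"
    unfolding \<tau>_def
  proof (rule integral_dominated_convergence[OF _ _ int])
    show "AE t in lborel. (\<lambda>n. indicator {t. real n \<le> \<bar>t\<bar>} t * (norm (f t))\<^sup>2) \<longlonglongrightarrow> 0"
    proof (intro AE_I2 tendsto_eventually)
      fix t :: real
      show "\<forall>\<^sub>F n in sequentially. indicator {t. real n \<le> \<bar>t\<bar>} t * (norm (f t))\<^sup>2 = 0"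
        using eventually_gt_at_top[of "nat \<lceil>\<bar>t\<bar>\<rceil>"]
      proof eventually_elim
        case (elim n)
        then have "\<bar>t\<bar> < real n" by linarith
        then show ?case by simp
      qed
    qed
    show "AE t in lborel. norm (indicator {t. real n \<le> \<bar>t\<bar>} t * (norm (f t))\<^sup>2) \<le> (norm (f t))\<^sup>2" for n
      by (intro AE_I2) (simp add: indicator_def)
  qed measurable
  then have "\<tau> \<longlonglongrightarrow> 0" by simp
  moreover have "0 < (e/2)\<^sup>2 * d" using e d by simp
  ultimately have "eventually (\<lambda>n. \<tau> n < (e/2)\<^sup>2 * d) sequentially" by (rule order_tendstoD)
  then obtain n where n: "\<tau> n < (e/2)\<^sup>2 * d" by (auto simp: eventually_sequentially)
  show "\<exists>b. \<forall>t. norm t \<ge> b \<longrightarrow> norm (f t - 0) < e"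
  proof (intro exI[of _ "real n + d"] allI impI, rule ccontr)
    fix t :: real assume t: "norm t \<ge> real n + d" and "\<not> norm (f t - 0) < e"
    then have ft: "norm (f t) \<ge> e" by simp
    have "(e/2)\<^sup>2 * d = (LINT s|lborel. (e/2)\<^sup>2 * indicator {t..t + d} s)"
      using d by simp
    also have "\<dots> \<le> \<tau> n"
      unfolding \<tau>_def
    proof (rule integral_mono)
      show "integrable lborel (\<lambda>s. (e/2)\<^sup>2 * indicator {t..t + d} s :: real)"
        by (intro integrable_mult_right integrable_real_indicator) (simp_all add: emeasure_lborel_Icc_eq)
      show "integrable lborel (\<lambda>s. indicator {t. real n \<le> \<bar>t\<bar>} s * (norm (f s))\<^sup>2)"
      proof (rule Bochner_Integration.integrable_bound[OF int])
        show "AE s in lborel. norm (indicator {t. real n \<le> \<bar>t\<bar>} s * (norm (f s))\<^sup>2) \<le> norm ((norm (f s))\<^sup>2)"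
          by (intro AE_I2) (simp add: indicator_def)
      qed measurable
      fix s
      show "(e/2)\<^sup>2 * indicator {t..t + d} s \<le> indicator {t. real n \<le> \<bar>t\<bar>} s * (norm (f s))\<^sup>2"
      proof (cases "s \<in> {t..t + d}")
        case True
        have "M * \<bar>t - s\<bar> \<le> M * d" using True M0 by (intro mult_left_mono) auto
        then have "norm (f t - f s) \<le> e / 2" using M[of t s] d by linarith
        then have "e / 2 \<le> norm (f s)" using ft norm_triangle_ineq2[of "f t" "f s"] by linarith
        then have "(e/2)\<^sup>2 \<le> (norm (f s))\<^sup>2" using e by (intro power_mono) auto
        moreover have "real n \<le> \<bar>s\<bar>" using True t by auto
        ultimately show ?thesis using True by simp
      qed simp
    qed
    finally show False using n by simp
  qed
qed

lemma norm_cis_diff_le: "norm (cis a - cis b) \<le> \<bar>a - b\<bar>"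
proof -
  have "cis a - cis b = cis b * (cis (a - b) - 1)"
    by (simp add: right_diff_distrib cis_mult)
  then have "norm (cis a - cis b) = norm (cis (a - b) - 1)"
    by (simp add: norm_mult)
  also have "\<dots> \<le> \<bar>a - b\<bar>"
    using iexp_approx1[of "a - b" 0] by (simp add: cis_conv_exp)
  finally show ?thesis .
qed

text \<open>A function with integrable transform supported in \<open>[-\<delta>, \<delta>]\<close> is Lipschitz, with constant
  \<open>2 \<pi> |\<delta>|\<close> times the \<open>L\<^sup>1\<close> norm of that transform.\<close>

lemma paley_wiener_tendsto_0:
  assumes f: "f \<in> paley_wiener \<delta>"
  shows "(f \<longlongrightarrow> 0) at_infinity"
proof -
  obtain g where g: "square_integrable g" "integrable lborel g" "\<And>v. v \<notin> {-\<delta>..\<delta>} \<Longrightarrow> g v = 0"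
    "L2_norm_real g \<le> L2_norm_real f" "\<And>s. f s = (LINT v|lborel. g v * cis (2 * pi * s * v))"
    using paley_wiener_representation[OF f] by blast
  note [measurable] = borel_measurable_integrable[OF g(2)]
  have gcis: "integrable lborel (\<lambda>v. g v * cis (2 * pi * s * v))" for s
    using g(2) by (intro integrable_mult_cis) auto
  show ?thesis
  proof (rule Lipschitz_square_integrable_tendsto_0)
    show "square_integrable f" using f by (simp add: paley_wiener_def)
    fix s t
    have "f s - f t = (LINT v|lborel. g v * (cis (2 * pi * s * v) - cis (2 * pi * t * v)))"
      unfolding g(5) right_diff_distrib using gcis by simp
    also have "norm \<dots> \<le> (LINT v|lborel. norm (g v) * (2 * pi * \<bar>\<delta>\<bar> * \<bar>s - t\<bar>))"
    proof (rule order_trans[OF integral_norm_bound integral_mono])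
      show "integrable lborel (\<lambda>v. norm (g v * (cis (2 * pi * s * v) - cis (2 * pi * t * v))))"
        unfolding right_diff_distrib using gcis by simp
      show "integrable lborel (\<lambda>v. norm (g v) * (2 * pi * \<bar>\<delta>\<bar> * \<bar>s - t\<bar>))" using g(2) by simp
      fix v
      show "norm (g v * (cis (2 * pi * s * v) - cis (2 * pi * t * v))) \<le> norm (g v) * (2 * pi * \<bar>\<delta>\<bar> * \<bar>s - t\<bar>)"
      proof (cases "v \<in> {-\<delta>..\<delta>}")
        case True
        have "norm (cis (2 * pi * s * v) - cis (2 * pi * t * v)) \<le> \<bar>2 * pi * s * v - 2 * pi * t * v\<bar>"
          by (rule norm_cis_diff_le)
        also have "2 * pi * s * v - 2 * pi * t * v = 2 * pi * v * (s - t)"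
          by (simp add: algebra_simps)
        also have "\<bar>2 * pi * v * (s - t)\<bar> = 2 * pi * \<bar>v\<bar> * \<bar>s - t\<bar>"
          by (simp add: abs_mult)
        also have "\<dots> \<le> 2 * pi * \<bar>\<delta>\<bar> * \<bar>s - t\<bar>"
          using True by (intro mult_right_mono mult_left_mono) auto
        finally show ?thesis unfolding norm_mult by (rule mult_left_mono) simp
      qed (simp add: g(3))
    qed
    finally show "norm (f s - f t) \<le> (LINT v|lborel. norm (g v)) * (2 * pi * \<bar>\<delta>\<bar>) * \<bar>s - t\<bar>"
      by (simp add: mult.assoc)
  qed
qed

text \<open>The sharp cut-off is taken at \<open>\<plusminus>m\<close>, where \<open>sinc (\<pi> y)\<close> vanishes. So cutting off sinc agrees with
  composing it with the projection onto \<open>[-m, m]\<close>, which is visibly continuous.\<close>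

lemma sinc_cutoff_eq_clamp:
  assumes L: "L > 0" and m: "m \<ge> 1"
  shows "of_real (sinc (pi * (L * t - of_int l))) * indicator {- (real m / L)..real m / L} (t - of_int l / L)
    = complex_of_real (sinc (pi * max (- real m) (min (real m) (L * t - of_int l))))"
proof (cases "\<bar>L * t - of_int l\<bar> \<le> real m")
  case True
  then have "max (- real m) (min (real m) (L * t - of_int l)) = L * t - of_int l" by auto
  moreover have "t - of_int l / L \<in> {- (real m / L)..real m / L}"
    unfolding sampling_window_iff[OF L] by (rule True)
  ultimately show ?thesis by (simp only: indicator_simps mult_1_right)
next
  case False
  let ?y = "max (- real m) (min (real m) (L * t - of_int l))"
  have "?y = of_int (int m) \<or> ?y = of_int (- int m)" using False by auto
  then have "sinc (pi * ?y) = 0"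
    using sinc_pi_int[of "int m"] sinc_pi_int[of "- int m"] m by (elim disjE) simp_all
  moreover have "t - of_int l / L \<notin> {- (real m / L)..real m / L}"
    unfolding sampling_window_iff[OF L] by (rule False)
  ultimately show ?thesis
    by (simp only: indicator_simps(2) mult_zero_right of_real_0 not_False_eq_True)
qed

text \<open>All windows of points at distance less than \<open>1/L\<close> from \<open>t\<^sub>0\<close> lie in the window of half-width \<open>m + 1\<close> at
  \<open>t\<^sub>0\<close>, so near \<open>t\<^sub>0\<close> the formula is a fixed finite sum of continuous functions.\<close>

lemma continuous_on_R_rect:
  assumes L: "L > 0" and m: "m \<ge> 1"
  shows "continuous_on UNIV (R_rect L m f)"
proof (rule continuous_at_imp_continuous_on, rule ballI)
  fix t0 :: real
  define J where "J = {l::int. \<bar>L * t0 - of_int l\<bar> \<le> real (m + 1)}"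
  let ?S = "\<lambda>t. \<Sum>l\<in>J. f (of_int l / L) * complex_of_real (sinc (pi * max (- real m) (min (real m) (L * t - of_int l))))"
  have eq: "R_rect L m f t = ?S t" if "t \<in> ball t0 (1 / L)" for t
  proof -
    have "\<bar>t0 - t\<bar> * L < 1"
      using that L by (simp add: dist_real_def pos_less_divide_eq)
    moreover have "\<bar>L * t0 - L * t\<bar> = \<bar>t0 - t\<bar> * L"
      using L by (simp add: abs_mult flip: right_diff_distrib)
    ultimately have "\<bar>L * t0 - L * t\<bar> < 1" by simp
    then have sub: "{l::int. \<bar>L * t - of_int l\<bar> \<le> real m} \<subseteq> J"
      unfolding J_def by (auto simp: abs_if split: if_splits)
    have "finite J" unfolding J_def by (rule finite_int_window)
    from R_rect_eq_sum[OF L this sub, of f] show ?thesis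
      unfolding mult.assoc sinc_cutoff_eq_clamp[OF L m] .
  qed
  have "continuous_on (ball t0 (1 / L)) ?S"
    by (intro continuous_intros)
  moreover have "continuous_on (ball t0 (1 / L)) (R_rect L m f) \<longleftrightarrow> continuous_on (ball t0 (1 / L)) ?S"
    by (intro continuous_on_cong refl eq)
  ultimately have "continuous_on (ball t0 (1 / L)) (R_rect L m f)" by blast
  then show "isCont (R_rect L m f) t0"
    using L by (simp add: continuous_on_eq_continuous_at)
qed

text \<open>At most \<open>2 m + 1\<close> samples contribute at \<open>t\<close>, all of them taken near \<open>t\<close> and with weights at most 1.\<close>

lemma R_rect_tendsto_0:
  assumes L: "L > 0" and f: "(f \<longlongrightarrow> 0) at_infinity"
  shows "(R_rect L m f \<longlongrightarrow> 0) at_infinity"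
  unfolding Lim_at_infinity dist_norm
proof (intro allI impI)
  fix e :: real assume e: "e > 0"
  \<comment> \<open>One more than the number of samples, so that the final inequality is strict.\<close>
  define e' where "e' = e / real (2 * m + 2)"
  have e': "e' > 0" "real (2 * m + 1) * e' < e"
    using e by (auto simp: e'_def field_simps)
  obtain b where b: "\<And>s. norm s \<ge> b \<Longrightarrow> norm (f s) < e'"
    using f e'(1) unfolding Lim_at_infinity dist_norm by auto
  show "\<exists>B. \<forall>t. norm t \<ge> B \<longrightarrow> norm (R_rect L m f t - 0) < e"
  proof (intro exI[of _ "b + real (m + 1) / L"] allI impI)
    fix t :: real assume t: "norm t \<ge> b + real (m + 1) / L"
    define J where "J = {\<lfloor>L * t\<rfloor> - int m..\<lfloor>L * t\<rfloor> + int m}"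
    have sub: "{l::int. \<bar>L * t - of_int l\<bar> \<le> real m} \<subseteq> J"
    proof
      fix l :: int assume "l \<in> {l::int. \<bar>L * t - of_int l\<bar> \<le> real m}"
      then have "\<bar>L * t - of_int l\<bar> \<le> real m" by simp
      then show "l \<in> J" unfolding J_def atLeastAtMost_iff by (intro conjI; linarith)
    qed
    have "finite J" unfolding J_def by simp
    have "norm (R_rect L m f t) \<le> (\<Sum>l\<in>J. e')"
      unfolding R_rect_eq_sum[OF L \<open>finite J\<close> sub]
    proof (rule sum_norm_le)
      fix l assume "l \<in> J"
      then have "\<bar>L * t - of_int l\<bar> \<le> real (m + 1)" unfolding J_def by simp linarith
      then have "\<bar>t - of_int l / L\<bar> \<le> real (m + 1) / L"
        unfolding sampling_window_iff[OF L, symmetric] by (simp add: abs_le_iff)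
      then have "norm (of_int l / L) \<ge> b" using t unfolding real_norm_def by linarith
      then have "norm (f (of_int l / L)) \<le> e'" by (rule b[THEN less_imp_le])
      moreover have "\<bar>sinc (pi * (L * t - of_int l))\<bar> \<le> 1"
        using abs_sin_x_le_abs_x[of "pi * (L * t - of_int l)"] by (simp add: divide_le_eq_1)
      ultimately have "norm (f (of_int l / L)) * \<bar>sinc (pi * (L * t - of_int l))\<bar> * 1 \<le> e' * 1 * 1"
        using e'(1) by (intro mult_mono) auto
      then show "norm (f (of_int l / L) * complex_of_real (sinc (pi * (L * t - of_int l))) *
          indicator {- (real m / L)..real m / L} (t - of_int l / L)) \<le> e'"
        using e'(1) unfolding norm_mult norm_of_real by (cases "t - of_int l / L \<in> {- (real m / L)..real m / L}") simp_all
    qed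
    also have "\<dots> = real (2 * m + 1) * e'" by (simp add: J_def)
    also have "\<dots> < e" by (rule e'(2))
    finally show "norm (R_rect L m f t - 0) < e" by simp
  qed
qed

theorem lemma3p1:
  fixes N m :: nat and lam L :: real and f :: "real \<Rightarrow> complex"
  assumes "N \<ge> 1"
    and "lam \<ge> 0"
    and "L = real N * (1 + lam)"
    and "m \<ge> 2"
    and "f \<in> paley_wiener (real N / 2)"
  shows "(\<lambda>t. f t - R_rect L m f t) \<in> C0_space \<and>
    C0_norm (\<lambda>t. f t - R_rect L m f t)
      \<le> sqrt L / pi * sqrt (2 / real m + 1 / (real m)\<^sup>2) * L2_norm_real f"
proof
  have NL: "real N \<le> L" using assms(2,3) by (simp add: mult_le_cancel_left1)
  then have L: "L > 0" using assms(1) by simp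
  have m: "m \<ge> 1" using assms(4) by simp
  have "continuous_on UNIV f"
    using assms(5) by (auto simp: paley_wiener_def intro: smooth_fun_continuous)
  moreover have f0: "(f \<longlongrightarrow> 0) at_infinity" by (rule paley_wiener_tendsto_0[OF assms(5)])
  moreover have "((\<lambda>t. f t - R_rect L m f t) \<longlongrightarrow> 0 - 0) at_infinity"
    by (intro tendsto_diff f0 R_rect_tendsto_0[OF L])
  ultimately show "(\<lambda>t. f t - R_rect L m f t) \<in> C0_space"
    using continuous_on_R_rect[OF L m, of f]
    by (auto simp: C0_space_def intro!: continuous_intros)
  show "C0_norm (\<lambda>t. f t - R_rect L m f t)
      \<le> sqrt L / pi * sqrt (2 / real m + 1 / (real m)\<^sup>2) * L2_norm_real f"
    unfolding C0_norm_def
    using NL by (intro cSUP_least paley_wiener_R_rect_error[OF assms(5) _ L m]) auto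
qed

end
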